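(* Let $m\in\mathbb{N}_0$ and let $Z_m:\Omega\times\Omega\to\mathbb{C}$ be the complex zonal harmonic of degree $m$. (a) For every $T\in\mathcal{M}$ and all $(z,w),(u,v)\in\Omega$ we have $Z_m\big(T(z,w),T(u,v)\big)=Z_m\big((z,w),(u,v)\big)$. In particular, $Z_m\big((z,w),(u,v)\big)$ depends only on the vector $T_{u,v}(z,w)$ (if $u,v\in\mathbb{C}$) resp. $\widetilde{T}_{u,v}(z,w)$ (if $u,v\in\widehat{\mathbb{C}}\setminus\{0\}$). (b) Fix $(u,v)\in\Omega$. Then $Z_m^{u,v}:=Z_m\big(\cdot,(u,v)\big)$ is the unique (up to a multiplicative factor) function in $X_{4m(m+1)}(\Omega)$ that is invariant with respect to all automorphisms in $\mathcal{M}$ that fix $(u,v)$, i.e. such that $Z_m^{u,v}\circ T=Z_m^{u,v}$ for every $T\in\mathcal{M}$ with $T(u,v)=(u,v)$.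
   Context: $\mathbb{N}_0=\{0,1,2,\dots\}$, $\widehat{\mathbb{C}}=\mathbb{C}\cup\{\infty\}$, with the conventions $\infty\cdot 0=0\cdot\infty=1$, $\infty\cdot z=z\cdot\infty=\infty$ for $z\in\widehat{\mathbb{C}}\setminus\{0\}$, $1/0=\infty$, $1/\infty=0$. $\Omega=\{(z,w)\in\widehat{\mathbb{C}}^2 : z\cdot w\ne 1\}$, open in $\widehat{\mathbb{C}}^2$; $\mathcal{H}(\Omega)$ is the space of holomorphic functions $\Omega\to\mathbb{C}$. For $F\in\mathcal{H}(\Omega)$, $\Delta_{zw}F(z,w)=4(1-zw)^2\partial_z\partial_wF(z,w)$ (understood by holomorphic extension at points with a coordinate $\infty$), and $X_\lambda(\Omega)=\{F\in\mathcal{H}(\Omega):\Delta_{zw}F=\lambda F\}$. Poisson Fourier modes: for $m\in\mathbb{N}_0$, $n\in\mathbb{Z}$, $P_n^{-m}:\Omega\to\mathbb{C}$ is $$P_n^{-m}(z,w)=(-1)^n\binom{m}{|n|}(1-zw)^{-m}\,{}_2F_1(-m,|n|-m;|n|+1;zw)\cdot\begin{cases}w^n & n\ge 0\\ z^{|n|} & n\le 0\end{cases}$$ with $\binom{m}{|n|}=0$ if $|n|>m$ and ${}_2F_1(a,b;c;t)=\sum_{k\ge0}\frac{(a)_k(b)_k}{(c)_k}\frac{t^k}{k!}$ (a finite sum here), $(a)_k=a(a+1)\cdots(a+k-1)$. Equivalently, for $n\ge0$, $P_n^{-m}(z,w)=(-1)^n\sum_{k=0}^{m-n}\binom{m}{k+n}\binom{m}{k}\frac{z^kw^{k+n}}{(1-zw)^m}=P_{-n}^{-m}(w,z)$.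 At points of $\Omega$ with a coordinate equal to $\infty$ the formulas are understood via the (unique) holomorphic extension. Complex zonal harmonic: for $|n|\le m$ let $Y_n^{-m}=\sqrt{2m+1}\,\binom{m}{|n|}^{-1/2}\binom{-m-1}{|n|}^{1/2}P_n^{-m}$, where $\binom{-m-1}{k}=(-1)^k\binom{m+k}{k}$ and a fixed square root depending only on $m$ and $|n|$ is used. Then $Z_m\big((z,w),(u,v)\big)=\sum_{j=-m}^m Y_j^{-m}(z,w)\,Y_{-j}^{-m}(u,v)$. Möbius group of $\Omega$: $\mathcal{M}$ consists of all maps $(z,w)\mapsto\big(\psi(z),\tfrac{1}{\psi(1/w)}\big)$ and all maps $(z,w)\mapsto\big(\psi(w),\tfrac{1}{\psi(1/z)}\big)$ of $\Omega$ onto itself, where $\psi$ ranges over the Möbius transformations (biholomorphic automorphisms) of $\widehat{\mathbb{C}}$. For $(u,v)\in\Omega$ with $u,v\in\mathbb{C}$, $T_{u,v}(z,w)=\left(\frac{u-z}{1-vz},\frac{v-w}{1-uw}\right)$, $(z,w)\in\Omega$ (appropriate limits at $\infty$). For $(u,v)\in\Omega$ with $u,v\in\widehat{\mathbb{C}}\setminus\{0\}$, $\widetilde{T}_{u,v}(z,w)=T_{1/v,1/u}\left(\frac1w,\frac1z\right)$. *)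

theory Defs
  imports "HOL-Complex_Analysis.Complex_Analysis"
begin

text \<open>
  The Riemann sphere, with the conventions \<open>\<infinity> \<cdot> 0 = 0 \<cdot> \<infinity> = 1\<close>, \<open>\<infinity> \<cdot> z = z \<cdot> \<infinity> = \<infinity>\<close> for
  \<open>z \<noteq> 0\<close>, \<open>1 / 0 = \<infinity>\<close> and \<open>1 / \<infinity> = 0\<close>.  The selector \<open>the_Fin\<close> is only ever applied to
  finite points.
\<close>

datatype sphere = Fin (the_Fin: complex) | Infty

fun sphere_mult :: "sphere \<Rightarrow> sphere \<Rightarrow> sphere" where
  "sphere_mult (Fin z) (Fin w) = Fin (z * w)"
| "sphere_mult Infty w = (if w = Fin 0 then Fin 1 else Infty)"
| "sphere_mult z Infty = (if z = Fin 0 then Fin 1 else Infty)"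

fun sphere_inverse :: "sphere \<Rightarrow> sphere" where
  "sphere_inverse (Fin z) = (if z = 0 then Infty else Fin (inverse z))"
| "sphere_inverse Infty = Fin 0"

definition \<Omega> :: "(sphere \<times> sphere) set" where
  "\<Omega> = {(z, w). sphere_mult z w \<noteq> Fin 1}"

text \<open>
  Holomorphy in two variables is complex Frechet differentiability.  The sphere carries the two
  charts \<open>z\<close> and \<open>1 / z\<close> (given here by their inverse maps); holomorphy on \<open>\<Omega>\<close> is holomorphy
  in all four product charts.  Functions on \<open>\<Omega>\<close> are represented by total functions whose values
  outside \<open>\<Omega>\<close> are irrelevant.
\<close>

definition holomorphic2_on :: "(complex \<times> complex \<Rightarrow> complex) \<Rightarrow> (complex \<times> complex) set \<Rightarrow> bool"
  where "holomorphic2_on f S \<longleftrightarrow>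
    (\<forall>p\<in>S. \<exists>a b. (f has_derivative (\<lambda>(h, k). a * h + b * k)) (at p))"

definition sphere_charts :: "(complex \<Rightarrow> sphere) set" where
  "sphere_charts = {Fin, \<lambda>s. sphere_inverse (Fin s)}"

definition hol_\<Omega> :: "(sphere \<times> sphere \<Rightarrow> complex) set" where
  "hol_\<Omega> = {F. \<forall>\<phi>\<in>sphere_charts. \<forall>\<psi>\<in>sphere_charts.
     holomorphic2_on (\<lambda>(s, t). F (\<phi> s, \<psi> t)) {(s, t). (\<phi> s, \<psi> t) \<in> \<Omega>}}"

text \<open>
  The holomorphic extension to \<open>\<Omega>\<close> of a function given on the finite points of \<open>\<Omega>\<close>; its values
  on \<open>\<Omega>\<close> do not depend on the choice made, see \<open>hol_ext_eq\<close> below.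
\<close>

definition hol_ext :: "(complex \<Rightarrow> complex \<Rightarrow> complex) \<Rightarrow> sphere \<times> sphere \<Rightarrow> complex" where
  "hol_ext f = (SOME G. G \<in> hol_\<Omega> \<and> (\<forall>z w. (Fin z, Fin w) \<in> \<Omega> \<longrightarrow> G (Fin z, Fin w) = f z w))"

lemma \<Omega>_chart_nhds:
  assumes "\<phi> \<in> sphere_charts" "\<psi> \<in> sphere_charts" "(\<phi> s, \<psi> t) \<in> \<Omega>"
  shows "\<forall>\<^sub>F e in at (0::complex). (\<exists>z w. \<phi> (s + e) = Fin z \<and> \<psi> (t + e) = Fin w) \<and>
           (\<phi> (s + e), \<psi> (t + e)) \<in> \<Omega>"
proof -
  have lim: "((\<lambda>e. c + e) \<longlongrightarrow> c) (at (0::complex))" for c :: complex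
    using tendsto_add[OF tendsto_const[of c] tendsto_ident_at[of 0 UNIV]] by simp
  have ne: "\<forall>\<^sub>F e in at (0::complex). c + e \<noteq> 0" for c :: complex
  proof (cases "c = 0")
    case True
    then show ?thesis by (simp add: eventually_at_filter)
  next
    case False
    show ?thesis using tendsto_imp_eventually_ne[OF lim False] .
  qed
  have prod: "\<forall>\<^sub>F e in at (0::complex). (s + e) * (t + e) \<noteq> 1" if "s * t \<noteq> 1"
    using tendsto_imp_eventually_ne[OF tendsto_mult[OF lim lim] that] .
  have inv: "inverse x * y = 1 \<longleftrightarrow> x = y" "y * inverse x = 1 \<longleftrightarrow> x = y" if "x \<noteq> 0" for x y :: complex
    using that by (auto simp: field_simps)
  have inv2: "inverse x * inverse y = 1 \<longleftrightarrow> x * y = 1" if "x \<noteq> 0" "y \<noteq> 0" for x y :: complex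
    using that by (metis inverse_mult_distrib inverse_1 inverse_eq_iff_eq)
  consider "\<phi> = Fin" "\<psi> = Fin" | "\<phi> = Fin" "\<psi> = (\<lambda>s. sphere_inverse (Fin s))"
    | "\<phi> = (\<lambda>s. sphere_inverse (Fin s))" "\<psi> = Fin"
    | "\<phi> = (\<lambda>s. sphere_inverse (Fin s))" "\<psi> = (\<lambda>s. sphere_inverse (Fin s))"
    using assms(1,2) by (auto simp: sphere_charts_def)
  then show ?thesis
  proof cases
    case 1
    then show ?thesis using assms(3) prod by (simp add: \<Omega>_def)
  next
    case 2
    have "s \<noteq> t" using assms(3) 2 by (auto simp: \<Omega>_def split: if_splits)
    show ?thesis
      by (rule eventually_mono[OF ne[of t]]) (use \<open>s \<noteq> t\<close> in \<open>auto simp: 2 \<Omega>_def inv\<close>)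
  next
    case 3
    have "s \<noteq> t" using assms(3) 3 by (auto simp: \<Omega>_def split: if_splits)
    show ?thesis
      by (rule eventually_mono[OF ne[of s]]) (use \<open>s \<noteq> t\<close> in \<open>auto simp: 3 \<Omega>_def inv\<close>)
  next
    case 4
    have "s * t \<noteq> 1" using assms(3) 4 by (auto simp: \<Omega>_def inv2 split: if_splits)
    from ne[of s] ne[of t] prod[OF this] show ?thesis
      by eventually_elim (auto simp: 4 \<Omega>_def inv2)
  qed
qed

lemma hol_\<Omega>_eqI:
  assumes "F \<in> hol_\<Omega>" "G \<in> hol_\<Omega>"
    and eq: "\<And>z w. (Fin z, Fin w) \<in> \<Omega> \<Longrightarrow> F (Fin z, Fin w) = G (Fin z, Fin w)"
    and "p \<in> \<Omega>"
  shows "F p = G p"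
proof -
  have ch: "\<exists>\<phi>\<in>sphere_charts. \<exists>s. x = \<phi> s" for x
    by (cases x) (auto simp: sphere_charts_def intro: exI[of _ 0])
  obtain x y where p: "p = (x, y)" by (cases p)
  obtain \<phi> s \<psi> t where c: "\<phi> \<in> sphere_charts" "\<psi> \<in> sphere_charts" "x = \<phi> s" "y = \<psi> t"
    using ch[of x] ch[of y] by blast
  have lim: "((\<lambda>e. (s + e, t + e)) \<longlongrightarrow> (s, t)) (at (0::complex))"
    using tendsto_Pair[OF tendsto_add[OF tendsto_const[of s] tendsto_ident_at[of 0 UNIV]]
        tendsto_add[OF tendsto_const[of t] tendsto_ident_at[of 0 UNIV]]] by simp
  have cont: "((\<lambda>e. H (\<phi> (s + e), \<psi> (t + e))) \<longlongrightarrow> H (\<phi> s, \<psi> t)) (at 0)" if "H \<in> hol_\<Omega>" for H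
  proof -
    have "(s, t) \<in> {(s, t). (\<phi> s, \<psi> t) \<in> \<Omega>}"
      using assms(4) p c by simp
    moreover have "holomorphic2_on (\<lambda>(s, t). H (\<phi> s, \<psi> t)) {(s, t). (\<phi> s, \<psi> t) \<in> \<Omega>}"
      using that c(1,2) by (simp add: hol_\<Omega>_def)
    ultimately have "isCont (\<lambda>(s, t). H (\<phi> s, \<psi> t)) (s, t)"
      unfolding holomorphic2_on_def using has_derivative_continuous by blast
    from isCont_tendsto_compose[OF this lim] show ?thesis by simp
  qed
  have "\<forall>\<^sub>F e in at 0. F (\<phi> (s + e), \<psi> (t + e)) = G (\<phi> (s + e), \<psi> (t + e))"
  proof -
    have "(\<phi> s, \<psi> t) \<in> \<Omega>" using assms(4) p c by simp
    from \<Omega>_chart_nhds[OF c(1,2) this] show ?thesis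
      by (rule eventually_mono) (use eq in force)
  qed
  from this cont[OF assms(1)] have "((\<lambda>e. G (\<phi> (s + e), \<psi> (t + e))) \<longlongrightarrow> F (\<phi> s, \<psi> t)) (at 0)"
    by (rule tendsto_cong[THEN iffD1])
  from tendsto_unique[OF _ this cont[OF assms(2)]] show ?thesis
    by (simp add: p c)
qed

lemma hol_ext_eq:
  assumes "G \<in> hol_\<Omega>" "\<And>z w. (Fin z, Fin w) \<in> \<Omega> \<Longrightarrow> G (Fin z, Fin w) = f z w" "p \<in> \<Omega>"
  shows "hol_ext f p = G p"
proof -
  let ?Q = "\<lambda>G. G \<in> hol_\<Omega> \<and> (\<forall>z w. (Fin z, Fin w) \<in> \<Omega> \<longrightarrow> G (Fin z, Fin w) = f z w)"
  have "?Q (hol_ext f)"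
    unfolding hol_ext_def by (rule someI[of ?Q G]) (use assms in auto)
  then show ?thesis
    using hol_\<Omega>_eqI[of \<open>hol_ext f\<close> G p] assms by simp
qed

definition laplacian :: "(sphere \<times> sphere \<Rightarrow> complex) \<Rightarrow> sphere \<times> sphere \<Rightarrow> complex" where
  "laplacian F = hol_ext (\<lambda>z w.
     4 * (1 - z * w)\<^sup>2 * deriv (\<lambda>z'. deriv (\<lambda>w'. F (Fin z', Fin w')) w) z)"

definition eigenspace_\<Omega> :: "complex \<Rightarrow> (sphere \<times> sphere \<Rightarrow> complex) set" where
  "eigenspace_\<Omega> l = {F \<in> hol_\<Omega>. \<forall>p\<in>\<Omega>. laplacian F p = l * F p}"

definition hyp2F1 :: "complex \<Rightarrow> complex \<Rightarrow> complex \<Rightarrow> complex \<Rightarrow> complex" where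
  "hyp2F1 a b c t = (\<Sum>k. pochhammer a k * pochhammer b k / pochhammer c k * (t ^ k / fact k))"

text \<open>The Poisson Fourier mode with upper index \<open>-m\<close> and lower index \<open>n\<close>.\<close>

definition poisson_mode :: "nat \<Rightarrow> int \<Rightarrow> sphere \<times> sphere \<Rightarrow> complex" where
  "poisson_mode m n = hol_ext (\<lambda>z w.
     (-1) powi n * of_nat (m choose nat \<bar>n\<bar>) * (1 - z * w) powi (- int m)
     * hyp2F1 (- of_nat m) (of_int \<bar>n\<bar> - of_nat m) (of_int \<bar>n\<bar> + 1) (z * w)
     * (if n \<ge> 0 then w ^ nat n else z ^ nat \<bar>n\<bar>))"

text \<open>
  \<open>csqrt\<close> fixes the square root of the (possibly negative) number \<open>(-m-1) gchoose |n|\<close>; it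
  depends only on \<open>m\<close> and \<open>|n|\<close>, and only its square enters the zonal harmonic.
\<close>

definition harmonic_mode :: "nat \<Rightarrow> int \<Rightarrow> sphere \<times> sphere \<Rightarrow> complex" where
  "harmonic_mode m n p =
     of_real (sqrt (2 * real m + 1)) * inverse (of_real (sqrt (real (m choose nat \<bar>n\<bar>))))
     * csqrt ((- of_nat m - 1) gchoose nat \<bar>n\<bar>) * poisson_mode m n p"

definition zonal :: "nat \<Rightarrow> sphere \<times> sphere \<Rightarrow> sphere \<times> sphere \<Rightarrow> complex" where
  "zonal m p q = (\<Sum>j = - int m..int m. harmonic_mode m j p * harmonic_mode m (- j) q)"

fun moebius :: "complex \<Rightarrow> complex \<Rightarrow> complex \<Rightarrow> complex \<Rightarrow> sphere \<Rightarrow> sphere" where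
  "moebius a b c d (Fin z) = (if c * z + d = 0 then Infty else Fin ((a * z + b) / (c * z + d)))"
| "moebius a b c d Infty = (if c = 0 then Infty else Fin (a / c))"

definition moebius_transformations :: "(sphere \<Rightarrow> sphere) set" where
  "moebius_transformations = {moebius a b c d | a b c d. a * d - b * c \<noteq> 0}"

text \<open>
  \<open>sphere_mult z w = Fin 1\<close> means \<open>z = sphere_inverse w\<close>, so injectivity of \<open>\<psi>\<close> makes each of the
  following maps a bijection of \<open>\<Omega>\<close> onto itself.
\<close>

definition moebius_group_\<Omega> :: "(sphere \<times> sphere \<Rightarrow> sphere \<times> sphere) set" where
  "moebius_group_\<Omega> =
     {(\<lambda>(z, w). (\<psi> z, sphere_inverse (\<psi> (sphere_inverse w)))) | \<psi>. \<psi> \<in> moebius_transformations} \<union>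
     {(\<lambda>(z, w). (\<psi> w, sphere_inverse (\<psi> (sphere_inverse z)))) | \<psi>. \<psi> \<in> moebius_transformations}"

text \<open>
  \<open>T_map u v (z, w) = ((u - z) / (1 - v z), (v - w) / (1 - u w))\<close>, extended to infinite arguments and
  values as Moebius transformations.
\<close>

definition T_map :: "complex \<Rightarrow> complex \<Rightarrow> sphere \<times> sphere \<Rightarrow> sphere \<times> sphere" where
  "T_map u v = (\<lambda>(z, w). (moebius (-1) u (-v) 1 z, moebius (-1) v (-u) 1 w))"

definition T_tilde :: "sphere \<Rightarrow> sphere \<Rightarrow> sphere \<times> sphere \<Rightarrow> sphere \<times> sphere" where
  "T_tilde u v = (\<lambda>(z, w).
     T_map (the_Fin (sphere_inverse v)) (the_Fin (sphere_inverse u))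
       (sphere_inverse w, sphere_inverse z))"

definition stabilizer_invariant :: "sphere \<times> sphere \<Rightarrow> (sphere \<times> sphere \<Rightarrow> complex) \<Rightarrow> bool" where
  "stabilizer_invariant q F \<longleftrightarrow>
     (\<forall>S\<in>moebius_group_\<Omega>. S q = q \<longrightarrow> (\<forall>p\<in>\<Omega>. F (S p) = F p))"

end

theory Submission
  imports Defs
begin

text \<open>
  To a point \<open>p = (z, w)\<close> of \<open>\<Omega>\<close> belongs the binary quadratic form
  \<open>quad p = (z + x) (1 + w x) / (1 - z w)\<close> in the variable \<open>x\<close>.  Its coefficients are holomorphic on all of
  \<open>\<Omega>\<close>, and a Moebius map acts on it by the corresponding linear substitution, divided by the
  determinant.  Up to signs the Poisson modes of degree \<open>m\<close> are the coefficients of the form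
  \<open>quad p ^ m\<close> of degree \<open>2 m\<close> (\<open>poisson_mode_eq\<close>), and the normalising factors of the harmonic modes
  are the weights of the classical invariant pairing of binary forms.  Hence
  \<open>zonal m p q = (2 m + 1) \<cdot> pairing m (quad p ^ m) (quad q ^ m)\<close> (\<open>zonal_eq_kernel\<close>), and the invariance
  of the zonal harmonic is the invariance of the pairing.  It is verified for translations, scalings,
  inversion and exchange of coordinates, which generate the group (\<open>zonal_kernel_invariant\<close>).  The
  maps \<open>T_map u v\<close> and \<open>T_tilde u v\<close> belong to the group and send \<open>(u, v)\<close> to the origin, so the zonal harmonic with pole
  \<open>(u, v)\<close> is the one with pole at the origin composed with them.

  Each coefficient of \<open>quad p ^ m\<close> is an eigenfunction of the Laplacian by a direct calculation
  (\<open>zonal_kernel_laplacian\<close>).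

  Uniqueness rests on the invariant of degree one, \<open>xi p q = pairing 1 (quad p) (quad q)\<close>, a finite
  number for all \<open>p, q\<close> in \<open>\<Omega>\<close>.  A holomorphic function that is invariant under the stabilizer of \<open>q\<close> has
  the form \<open>h (xi p q)\<close> with \<open>h\<close> entire (\<open>invariant_factors_through_xi\<close>).  On such functions the Laplacian
  is four times the Legendre operator \<open>(x\<^sup>2 - 1) h'' + 2 x h'\<close> (\<open>laplacian_xi\<close>);
  \<open>xi\<close> being holomorphic on \<open>\<Omega>\<close>, this formula also provides the extension of the Laplacian to infinite
  points.  The Legendre operator degenerates at \<open>x = 1 = xi q q\<close>, so an entire solution of the Legendre equation is determined
  by its value there (\<open>legendre_unique\<close>).  The zonal harmonic has the value \<open>2 m + 1 \<noteq> 0\<close> at \<open>q\<close>, hence all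
  invariant eigenfunctions are multiples of it.
\<close>

section \<open>Homogeneous coordinates and the Moebius group\<close>

text \<open>
  The point with homogeneous coordinates \<open>n : d\<close>.  Computing with them treats finite and infinite
  points alike: a Moebius map becomes linear, and the condition \<open>z w \<noteq> 1\<close> becomes the non-vanishing
  of a bilinear form, see \<open>moebius_pt\<close> and \<open>\<Omega>_pt_iff\<close>.
\<close>

definition pt :: "complex \<Rightarrow> complex \<Rightarrow> sphere" where
  "pt n d = (if d = 0 then Infty else Fin (n / d))"

lemma ex_pt: "\<exists>n d. (n \<noteq> 0 \<or> d \<noteq> 0) \<and> x = pt n d"
proof (cases x)
  case (Fin z)
  then have "x = pt z 1" by (simp add: pt_def)
  then show ?thesis by (metis zero_neq_one)
next
  case Infty
  then have "x = pt 1 0" by (simp add: pt_def)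
  then show ?thesis by (metis zero_neq_one)
qed

lemma pt_inverse: "n \<noteq> 0 \<or> d \<noteq> 0 \<Longrightarrow> sphere_inverse (pt n d) = pt d n"
  by (auto simp: pt_def)

lemma Fin_eq_pt: "Fin z = pt z 1"
  by (simp add: pt_def)

lemma inverse_Fin_eq_pt: "sphere_inverse (Fin s) = pt 1 s"
  by (simp add: pt_def inverse_eq_divide)

lemma sphere_inverse_inverse [simp]: "sphere_inverse (sphere_inverse x) = x"
  using ex_pt[of x] by (auto simp: pt_inverse)

lemma moebius_pt:
  assumes "n \<noteq> 0 \<or> e \<noteq> 0" "a * d - b * c \<noteq> 0"
  shows "moebius a b c d (pt n e) = pt (a * n + b * e) (c * n + d * e)"
    and "a * n + b * e \<noteq> 0 \<or> c * n + d * e \<noteq> 0"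
proof -
  show "moebius a b c d (pt n e) = pt (a * n + b * e) (c * n + d * e)"
  proof (cases "e = 0")
    case True
    then show ?thesis using assms by (auto simp: pt_def)
  next
    case False
    then have "c * (n / e) + d = (c * n + d * e) / e" "a * (n / e) + b = (a * n + b * e) / e"
      by (simp_all add: field_simps)
    then show ?thesis using False by (auto simp: pt_def)
  qed
  show "a * n + b * e \<noteq> 0 \<or> c * n + d * e \<noteq> 0"
  proof (rule ccontr)
    assume "\<not> ?thesis"
    then have h: "a * n + b * e = 0" "c * n + d * e = 0" by auto
    have "(a * d - b * c) * n = d * (a * n + b * e) - b * (c * n + d * e)"
         "(a * d - b * c) * e = a * (c * n + d * e) - c * (a * n + b * e)"
      by (simp_all add: algebra_simps)
    then show False using h assms by auto
  qed
qed

lemma \<Omega>_pt_iff: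
  assumes "z1 \<noteq> 0 \<or> z2 \<noteq> 0" "w1 \<noteq> 0 \<or> w2 \<noteq> 0"
  shows "(pt z1 z2, pt w1 w2) \<in> \<Omega> \<longleftrightarrow> z2 * w2 - z1 * w1 \<noteq> 0"
  using assms by (auto simp: \<Omega>_def pt_def field_simps)

lemma \<Omega>_cases:
  assumes "p \<in> \<Omega>"
  obtains z1 z2 w1 w2 where "p = (pt z1 z2, pt w1 w2)" "z1 \<noteq> 0 \<or> z2 \<noteq> 0" "w1 \<noteq> 0 \<or> w2 \<noteq> 0"
    "z2 * w2 - z1 * w1 \<noteq> 0"
proof -
  obtain x y where p: "p = (x, y)" by (cases p)
  obtain z1 z2 w1 w2 where "z1 \<noteq> 0 \<or> z2 \<noteq> 0" "x = pt z1 z2" "w1 \<noteq> 0 \<or> w2 \<noteq> 0" "y = pt w1 w2"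
    using ex_pt[of x] ex_pt[of y] by blast
  with assms p that show ?thesis by (simp add: \<Omega>_pt_iff)
qed

lemma Fin_in_\<Omega>_iff: "(Fin z, Fin w) \<in> \<Omega> \<longleftrightarrow> z * w \<noteq> 1"
  by (simp add: \<Omega>_def)

text \<open>
  In the coordinates \<open>z\<close> and \<open>1 / w\<close> the set \<open>\<Omega>\<close> consists of the pairs of distinct points of the
  sphere, and this is the diagonal action of \<open>\<psi>\<close> on such pairs.
\<close>

definition moebius_lift :: "(sphere \<Rightarrow> sphere) \<Rightarrow> sphere \<times> sphere \<Rightarrow> sphere \<times> sphere" where
  "moebius_lift \<psi> = (\<lambda>(z, w). (\<psi> z, sphere_inverse (\<psi> (sphere_inverse w))))"

lemma moebius_group_\<Omega>_eq:
  "moebius_group_\<Omega> = moebius_lift ` moebius_transformations \<union>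
     (\<lambda>\<psi>. moebius_lift \<psi> \<circ> prod.swap) ` moebius_transformations"
  by (auto simp: moebius_group_\<Omega>_def moebius_lift_def fun_eq_iff image_iff)

lemma moebius_lift_pt:
  assumes "z1 \<noteq> 0 \<or> z2 \<noteq> 0" "w1 \<noteq> 0 \<or> w2 \<noteq> 0" "a * d - b * c \<noteq> 0"
  shows "moebius_lift (moebius a b c d) (pt z1 z2, pt w1 w2) =
           (pt (a * z1 + b * z2) (c * z1 + d * z2), pt (c * w2 + d * w1) (a * w2 + b * w1))"
    and "a * z1 + b * z2 \<noteq> 0 \<or> c * z1 + d * z2 \<noteq> 0"
    and "c * w2 + d * w1 \<noteq> 0 \<or> a * w2 + b * w1 \<noteq> 0"
    and "(c * z1 + d * z2) * (a * w2 + b * w1) - (a * z1 + b * z2) * (c * w2 + d * w1) =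
           (a * d - b * c) * (z2 * w2 - z1 * w1)"
  using assms moebius_pt[of z1 z2 a d b c] moebius_pt[of w2 w1 a d b c]
  by (auto simp: moebius_lift_def pt_inverse algebra_simps)

lemma moebius_lift_in_\<Omega>:
  assumes "p \<in> \<Omega>" "\<psi> \<in> moebius_transformations"
  shows "moebius_lift \<psi> p \<in> \<Omega>"
proof -
  obtain a b c d where \<psi>: "\<psi> = moebius a b c d" "a * d - b * c \<noteq> 0"
    using assms(2) by (auto simp: moebius_transformations_def)
  from assms(1) show ?thesis
  proof (cases rule: \<Omega>_cases)
    case (1 z1 z2 w1 w2)
    note m = moebius_lift_pt[OF 1(2,3) \<psi>(2)]
    show ?thesis using m 1 \<psi> by (simp add: \<Omega>_pt_iff)
  qed
qed

lemma swap_in_\<Omega>: "p \<in> \<Omega> \<Longrightarrow> prod.swap p \<in> \<Omega>"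
  by (erule \<Omega>_cases) (auto simp: \<Omega>_pt_iff mult.commute)

lemma moebius_lift_comp:
  "moebius_lift \<psi> (moebius_lift \<psi>' p) = moebius_lift (\<psi> \<circ> \<psi>') p"
  by (cases p) (simp add: moebius_lift_def)

lemma moebius_comp:
  assumes "a * d - b * c \<noteq> 0" "a' * d' - b' * c' \<noteq> 0"
  shows "moebius a b c d \<circ> moebius a' b' c' d' =
    moebius (a * a' + b * c') (a * b' + b * d') (c * a' + d * c') (c * b' + d * d')"
    and "(a * a' + b * c') * (c * b' + d * d') - (a * b' + b * d') * (c * a' + d * c') \<noteq> 0"
proof -
  have "(a * a' + b * c') * (c * b' + d * d') - (a * b' + b * d') * (c * a' + d * c')
      = (a * d - b * c) * (a' * d' - b' * c')"
    by (simp add: algebra_simps)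
  with assms show det:
    "(a * a' + b * c') * (c * b' + d * d') - (a * b' + b * d') * (c * a' + d * c') \<noteq> 0"
    by simp
  show "moebius a b c d \<circ> moebius a' b' c' d' =
    moebius (a * a' + b * c') (a * b' + b * d') (c * a' + d * c') (c * b' + d * d')"
  proof
    fix x
    obtain n e where x: "n \<noteq> 0 \<or> e \<noteq> 0" "x = pt n e" using ex_pt by blast
    show "(moebius a b c d \<circ> moebius a' b' c' d') x =
      moebius (a * a' + b * c') (a * b' + b * d') (c * a' + d * c') (c * b' + d * d') x"
      using moebius_pt[OF x(1) assms(2)] moebius_pt[OF _ assms(1)] moebius_pt[OF x(1) det] x(2)
      by (simp add: algebra_simps)
  qed
qed

lemma moebius_diagonal: "moebius a 0 0 a = id" if "a \<noteq> 0"
proof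
  fix x show "moebius a 0 0 a x = id x" using that by (cases x) auto
qed

lemma moebius_transformations_comp:
  assumes "\<psi> \<in> moebius_transformations" "\<psi>' \<in> moebius_transformations"
  shows "\<psi> \<circ> \<psi>' \<in> moebius_transformations"
  using assms moebius_comp unfolding moebius_transformations_def by blast

lemma moebius_transformations_inverse:
  assumes "\<psi> \<in> moebius_transformations"
  obtains \<psi>' where "\<psi>' \<in> moebius_transformations" "\<psi> \<circ> \<psi>' = id" "\<psi>' \<circ> \<psi> = id"
proof -
  obtain a b c d where \<psi>: "\<psi> = moebius a b c d" and det: "a * d - b * c \<noteq> 0"
    using assms by (auto simp: moebius_transformations_def)
  have det': "d * a - (- b) * (- c) \<noteq> 0" using det by (simp add: mult.commute)
  let ?\<psi>' = "moebius d (- b) (- c) a"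
  have "?\<psi>' \<in> moebius_transformations"
    using det' unfolding moebius_transformations_def by blast
  moreover have "\<psi> \<circ> ?\<psi>' = id"
    unfolding \<psi> moebius_comp(1)[OF det det']
    using moebius_diagonal[OF det] by (simp add: mult.commute)
  moreover have "?\<psi>' \<circ> \<psi> = id"
    unfolding \<psi> moebius_comp(1)[OF det' det]
    using moebius_diagonal[OF det] by (simp add: mult.commute)
  ultimately show ?thesis by (rule that)
qed

lemma moebius_lift_id [simp]: "moebius_lift id p = p"
  by (cases p) (simp add: moebius_lift_def)

text \<open>
  A Moebius map can send \<open>0\<close> and \<open>\<infinity>\<close> to any two distinct points: the columns of its matrix are
  homogeneous coordinates of the two images.
\<close>

lemma moebius_lift_transitive:
  assumes "q \<in> \<Omega>"
  obtains \<psi> where "\<psi> \<in> moebius_transformations" "moebius_lift \<psi> (Fin 0, Fin 0) = q"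
  using assms
proof (cases rule: \<Omega>_cases)
  case (1 u1 u2 v1 v2)
  then have det: "v2 * u2 - u1 * v1 \<noteq> 0" by (simp add: mult.commute)
  have "moebius_lift (moebius v2 u1 v1 u2) (pt 0 1, pt 0 1) = q"
    using moebius_lift_pt(1)[of 0 1 0 1, OF _ _ det] 1 by simp
  then show ?thesis
    using that[of "moebius v2 u1 v1 u2"] det by (auto simp: moebius_transformations_def Fin_eq_pt)
qed

section \<open>Quadratic forms and the invariant pairing\<close>

fun sphere_num :: "sphere \<Rightarrow> complex" where
  "sphere_num (Fin z) = z" | "sphere_num Infty = 1"

fun sphere_den :: "sphere \<Rightarrow> complex" where
  "sphere_den (Fin z) = 1" | "sphere_den Infty = 0"

text \<open>
  The form \<open>(z + x) (1 + w x) / (1 - z w)\<close> in \<open>x\<close>, written in homogeneous coordinates.  Its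
  coefficients embed \<open>\<Omega>\<close> as the quadric of binary quadratic forms with discriminant \<open>1\<close> in \<open>\<complex>\<^sup>3\<close>; in
  particular they are finite at the infinite points of \<open>\<Omega>\<close>.
\<close>

definition quad :: "sphere \<times> sphere \<Rightarrow> complex poly" where
  "quad = (\<lambda>(x, y). smult (inverse (sphere_den x * sphere_den y - sphere_num x * sphere_num y))
     ([:sphere_num x, sphere_den x:] * [:sphere_den y, sphere_num y:]))"

text \<open>
  The expression is homogeneous of degree \<open>0\<close> in each pair of coordinates, so any homogeneous
  coordinates may be used.
\<close>

lemma quad_pt:
  assumes "z1 \<noteq> 0 \<or> z2 \<noteq> 0" "w1 \<noteq> 0 \<or> w2 \<noteq> 0"
  shows "quad (pt z1 z2, pt w1 w2) =
    smult (inverse (z2 * w2 - z1 * w1)) ([:z1, z2:] * [:w2, w1:])"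
proof -
  have num_den: "\<exists>k. k \<noteq> 0 \<and> n = k * sphere_num (pt n d) \<and> d = k * sphere_den (pt n d)"
    if "n \<noteq> 0 \<or> d \<noteq> 0" for n d
  proof (cases "d = 0")
    case True
    then show ?thesis using that by (intro exI[of _ n]) (simp add: pt_def)
  next
    case False
    then show ?thesis by (intro exI[of _ d]) (simp add: pt_def)
  qed
  obtain k l where k: "k \<noteq> 0" "z1 = k * sphere_num (pt z1 z2)" "z2 = k * sphere_den (pt z1 z2)"
    and l: "l \<noteq> 0" "w1 = l * sphere_num (pt w1 w2)" "w2 = l * sphere_den (pt w1 w2)"
    using num_den[OF assms(1)] num_den[OF assms(2)] by blast
  define a b a' b' where "a = sphere_num (pt z1 z2)" "b = sphere_den (pt z1 z2)"
    "a' = sphere_num (pt w1 w2)" "b' = sphere_den (pt w1 w2)"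
  note d = this
  have "z1 = k * a" "z2 = k * b" "w1 = l * a'" "w2 = l * b'"
    using k l by (simp_all only: d)
  then have "smult (inverse (z2 * w2 - z1 * w1)) ([:z1, z2:] * [:w2, w1:]) =
      smult (inverse (k * l * (b * b' - a * a'))) (smult (k * l) ([:a, b:] * [:b', a':]))"
    by (simp add: algebra_simps)
  also have "\<dots> = smult (inverse (b * b' - a * a')) ([:a, b:] * [:b', a':])"
  proof -
    have "inverse (k * l * c) * (k * l) = inverse c" for c
      using k(1) l(1) by (simp add: field_simps)
    then show ?thesis by (simp only: smult_smult)
  qed
  finally show ?thesis by (simp add: quad_def d)
qed

lemma quad_Fin: "quad (Fin z, Fin w) = smult (inverse (1 - z * w)) ([:z, 1:] * [:1, w:])"
  by (simp add: quad_def)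

lemma degree_quad_power: "degree (quad p ^ m) \<le> 2 * m"
proof -
  have "degree (quad p) \<le> 2"
    by (cases p) (auto simp: quad_def intro!: order.trans[OF degree_smult_le] order.trans[OF degree_pCons_le]
       simp flip: numeral_2_eq_2)
  then show ?thesis
    using degree_power_le[of "quad p" m] by (metis mult_le_mono1 order.trans)
qed

text \<open>
  Up to a factor this is the classical pairing of binary forms of degree \<open>2 m\<close> that is invariant
  under linear substitutions of determinant \<open>1\<close>.
\<close>

definition pairing :: "nat \<Rightarrow> complex poly \<Rightarrow> complex poly \<Rightarrow> complex" where
  "pairing m f g = (\<Sum>k\<le>2 * m. (-1) ^ (m + k) * fact k * fact (2 * m - k) / (fact m)\<^sup>2
     * coeff f k * coeff g (2 * m - k))"

text \<open>
  The derivative in \<open>\<tau>\<close> of \<open>f (x + \<tau>)\<close> is \<open>f' (x + \<tau>)\<close>, read off coefficient by coefficient.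
\<close>

lemma coeff_pcompose_shift_deriv:
  "((\<lambda>\<tau>. coeff (pcompose f [:\<tau>, 1:]) k) has_field_derivative
      of_nat (Suc k) * coeff (pcompose f [:\<tau>, 1:]) (Suc k)) (at (\<tau> :: complex))"
proof (induction f arbitrary: k)
  case 0
  then show ?case by simp
next
  case (pCons a f)
  define c where "c \<tau> k = coeff (pcompose f [:\<tau>, 1:]) k" for \<tau> k
  have IH: "((\<lambda>\<tau>. c \<tau> k) has_field_derivative of_nat (Suc k) * c \<tau> (Suc k)) (at \<tau>)" for k
    using pCons.IH by (simp add: c_def)
  have c: "coeff (pcompose (pCons a f) [:\<tau>, 1:]) k =
      (if k = 0 then a else c \<tau> (k - 1)) + \<tau> * c \<tau> k" for k \<tau>
    by (cases k) (simp_all add: pcompose_pCons c_def algebra_simps)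
  show ?case
  proof (cases k)
    case 0
    show ?thesis unfolding c 0
      by (auto intro!: derivative_eq_intros IH simp: algebra_simps)
  next
    case (Suc j)
    show ?thesis unfolding c Suc
      by (auto intro!: derivative_eq_intros IH simp: algebra_simps)
  qed
qed

text \<open>
  The derivative in \<open>\<tau>\<close> of the left-hand side telescopes: the weights satisfy
  \<open>(k + 1) \<omega> k + (2 m - k) \<omega> (k + 1) = 0\<close>, so that the term with index \<open>k\<close> in which \<open>f\<close> is differentiated
  cancels the term with index \<open>k + 1\<close> in which \<open>g\<close> is.
\<close>

lemma pairing_shift:
  assumes "degree f \<le> 2 * m" "degree g \<le> 2 * m"
  shows "pairing m (pcompose f [:\<tau>, 1:]) (pcompose g [:\<tau>, 1:]) = pairing m f g"
proof -
  define a where "a \<tau> k = coeff (pcompose f [:\<tau>, 1:]) k" for \<tau> k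
  define b where "b \<tau> k = coeff (pcompose g [:\<tau>, 1:]) k" for \<tau> k
  define \<omega> :: "nat \<Rightarrow> complex" where
    "\<omega> k = (-1) ^ (m + k) * fact k * fact (2 * m - k) / (fact m)\<^sup>2" for k
  have top: "a \<tau> (Suc (2 * m)) = 0" "b \<tau> (Suc (2 * m)) = 0" for \<tau>
    unfolding a_def b_def using assms
    by (auto intro!: coeff_eq_0 simp: degree_pcompose)
  have deriv: "((\<lambda>\<tau>. pairing m (pcompose f [:\<tau>, 1:]) (pcompose g [:\<tau>, 1:]))
      has_field_derivative 0) (at \<tau>)" for \<tau>
  proof -
    define X where "X k = (-1) ^ (m + k) * fact (Suc k) * fact (2 * m - k) / (fact m)\<^sup>2
      * a \<tau> (Suc k) * b \<tau> (2 * m - k)" for k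
    have 1: "\<omega> k * (of_nat (Suc k) * a \<tau> (Suc k)) * b \<tau> (2 * m - k) = X k" for k
      by (simp add: \<omega>_def X_def)
    \<comment> \<open>With \<open>X\<close> the contribution of the first argument, that of the second is \<open>X\<close> shifted, with the opposite sign.\<close>
    have 2: "\<omega> k * a \<tau> k * (of_nat (Suc (2 * m - k)) * b \<tau> (Suc (2 * m - k))) =
       (if k = 0 then 0 else - X (k - 1))" if "k \<le> 2 * m" for k
    proof (cases k)
      case 0
      then show ?thesis by (simp add: top)
    next
      case (Suc j)
      then have "2 * m - j = Suc (2 * m - k)" using that by simp
      then show ?thesis using Suc by (simp add: \<omega>_def X_def)
    qed
    have "((\<lambda>\<tau>. \<Sum>k\<le>2 * m. \<omega> k * a \<tau> k * b \<tau> (2 * m - k)) has_field_derivative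
       (\<Sum>k\<le>2 * m. \<omega> k * (of_nat (Suc k) * a \<tau> (Suc k)) * b \<tau> (2 * m - k)
          + \<omega> k * a \<tau> k * (of_nat (Suc (2 * m - k)) * b \<tau> (Suc (2 * m - k))))) (at \<tau>)"
      unfolding a_def b_def
      by (auto intro!: derivative_eq_intros coeff_pcompose_shift_deriv sum.cong simp: algebra_simps)
    moreover have "(\<Sum>k\<le>2 * m. \<omega> k * (of_nat (Suc k) * a \<tau> (Suc k)) * b \<tau> (2 * m - k)
          + \<omega> k * a \<tau> k * (of_nat (Suc (2 * m - k)) * b \<tau> (Suc (2 * m - k)))) =
       (\<Sum>k\<le>2 * m. X k - (if k = 0 then 0 else X (k - 1)))"
      by (rule sum.cong) (simp_all add: 1 2 del: of_nat_Suc)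
    also have "\<dots> = X (2 * m)"
    proof -
      have "(\<Sum>k\<le>n. X k - (if k = 0 then 0 else X (k - 1))) = X n" for n
        by (induction n) simp_all
      then show ?thesis .
    qed
    also have "\<dots> = 0" by (simp add: X_def top)
    finally show ?thesis by (simp add: pairing_def a_def b_def \<omega>_def)
  qed
  from has_field_derivative_zero_constant[OF convex_UNIV this] obtain c where
    "\<And>\<tau>. pairing m (pcompose f [:\<tau>, 1:]) (pcompose g [:\<tau>, 1:]) = c" by auto
  from this[of \<tau>] this[of 0] show ?thesis by (simp add: pcompose_idR)
qed

lemma coeff_pcompose_scale: "coeff (pcompose f [:0, c:]) k = c ^ k * coeff f k"
  for c :: complex
proof (induction f arbitrary: k)
  case 0
  then show ?case by simp
next
  case (pCons a f)
  then show ?case by (cases k) (simp_all add: pcompose_pCons)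
qed

lemma pairing_scale:
  assumes "r ^ 2 * c ^ (2 * m) = 1"
  shows "pairing m (smult r (pcompose f [:0, c:])) (smult r (pcompose g [:0, c:])) = pairing m f g"
  unfolding pairing_def
proof (rule sum.cong)
  fix k assume k: "k \<in> {..2 * m}"
  then have "c ^ k * c ^ (2 * m - k) = c ^ (2 * m)" by (simp flip: power_add)
  then have "r * (c ^ k * x) * (r * (c ^ (2 * m - k) * y)) = x * y" for x y
    using assms by (metis (no_types, opaque_lifting) mult.assoc mult.left_commute mult_1 power2_eq_square)
  then show "(-1) ^ (m + k) * fact k * fact (2 * m - k) / (fact m)\<^sup>2
     * coeff (smult r (pcompose f [:0, c:])) k * coeff (smult r (pcompose g [:0, c:])) (2 * m - k)
     = (-1) ^ (m + k) * fact k * fact (2 * m - k) / (fact m)\<^sup>2 * coeff f k * coeff g (2 * m - k)"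
    by (simp only: coeff_smult coeff_pcompose_scale mult.assoc)
qed simp

text \<open>
  The substitution \<open>x\<^sup>n f (1 / x)\<close> on coefficients.  Unlike \<open>reflect_poly\<close> it refers to a fixed formal
  degree \<open>n\<close>, since the forms considered here may have vanishing outer coefficients.
\<close>

definition reversal_of :: "nat \<Rightarrow> complex poly \<Rightarrow> complex poly \<Rightarrow> bool" where
  "reversal_of n f g \<longleftrightarrow> (\<forall>k\<le>n. coeff g k = coeff f (n - k))"

text \<open>
  Both sides are polynomials in \<open>x\<close> of degree at most \<open>n\<close> that agree at infinitely many points.
\<close>

lemma reversal_ofI:
  assumes "degree f \<le> n" "degree g \<le> n" "\<And>x. x \<noteq> 0 \<Longrightarrow> poly g x = x ^ n * poly f (inverse x)"
  shows "reversal_of n f g"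
proof -
  define h where "h = (\<Sum>k\<le>n. monom (coeff f (n - k)) k)"
  have "poly h x = poly g x" if "x \<noteq> 0" for x
  proof -
    have "poly f (inverse x) = (\<Sum>k\<le>n. coeff f k * inverse x ^ k)"
      unfolding poly_altdef using assms(1)
      by (intro sum.mono_neutral_left) (auto simp: coeff_eq_0)
    then have "poly g x = (\<Sum>k\<le>n. coeff f k * (x ^ n * inverse x ^ k))"
      by (simp add: assms(3)[OF that] sum_distrib_left algebra_simps)
    also have "\<dots> = (\<Sum>k\<le>n. coeff f k * x ^ (n - k))"
      using that by (intro sum.cong) (simp_all add: power_diff field_simps)
    also have "\<dots> = (\<Sum>k\<le>n. coeff f (n - k) * x ^ k)"
      by (rule sum.reindex_bij_witness[of _ "\<lambda>k. n - k" "\<lambda>k. n - k"]) auto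
    also have "\<dots> = poly h x" by (simp add: h_def poly_sum poly_monom)
    finally show ?thesis by simp
  qed
  then have "infinite {x. poly (h - g) x = 0}"
    by (intro infinite_super[of "- {0}" "{x. poly (h - g) x = 0}"]) (auto simp: infinite_UNIV_char_0 Compl_eq_Diff_UNIV)
  then have "h = g" using poly_roots_finite[of "h - g"] by auto
  moreover have "coeff h k = coeff f (n - k)" if "k \<le> n" for k
    using that by (simp add: h_def coeff_sum)
  ultimately show ?thesis by (simp add: reversal_of_def)
qed

lemma pairing_reversal:
  assumes "reversal_of (2 * m) f f'" "reversal_of (2 * m) g g'"
  shows "pairing m f' g' = pairing m f g"
proof -
  have "pairing m f' g' = (\<Sum>k\<le>2 * m. (-1) ^ (m + k) * fact k * fact (2 * m - k) / (fact m)\<^sup>2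
     * coeff f (2 * m - k) * coeff g k)"
    unfolding pairing_def using assms by (intro sum.cong) (auto simp: reversal_of_def)
  also have "\<dots> = pairing m f g"
    unfolding pairing_def
  proof (rule sum.reindex_bij_witness[of _ "\<lambda>k. 2 * m - k" "\<lambda>k. 2 * m - k"])
    fix k assume "k \<in> {..2 * m}"
    then have k: "k \<le> 2 * m" by simp
    then have "(-1 :: complex) ^ (m + k) = (-1) ^ (m + (2 * m - k))"
      by (auto simp: minus_one_power_iff)
    then show "(-1) ^ (m + (2 * m - k)) * fact (2 * m - k) * fact (2 * m - (2 * m - k)) / (fact m)\<^sup>2
      * coeff f (2 * m - k) * coeff g (2 * m - (2 * m - k)) =
     (-1) ^ (m + k) * fact k * fact (2 * m - k) / (fact m)\<^sup>2 * coeff f (2 * m - k) * coeff g k"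
      using k by simp
  qed auto
  finally show ?thesis .
qed

text \<open>
  The zonal harmonic without its factor \<open>2 m + 1\<close>, see \<open>zonal_eq_kernel\<close>.
\<close>

definition zonal_kernel :: "nat \<Rightarrow> sphere \<times> sphere \<Rightarrow> sphere \<times> sphere \<Rightarrow> complex" where
  "zonal_kernel m p q = pairing m (quad p ^ m) (quad q ^ m)"

lemma pcompose_power: "pcompose (f ^ m) g = pcompose f g ^ m"
  for f g :: "complex poly"
  by (induction m) (simp_all add: pcompose_mult pcompose_1)

lemma zonal_kernel_translate:
  assumes "p \<in> \<Omega>" "q \<in> \<Omega>"
  shows "zonal_kernel m (moebius_lift (moebius 1 \<tau> 0 1) p) (moebius_lift (moebius 1 \<tau> 0 1) q) =
    zonal_kernel m p q"
proof -
  have "quad (moebius_lift (moebius 1 \<tau> 0 1) p) = pcompose (quad p) [:\<tau>, 1:]" if "p \<in> \<Omega>" for p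
    using that
  proof (cases rule: \<Omega>_cases)
    case (1 z1 z2 w1 w2)
    have det: "1 * 1 - \<tau> * 0 \<noteq> 0" by simp
    note m = moebius_lift_pt[OF 1(2,3) det]
    show ?thesis
      unfolding 1(1) m(1) quad_pt[OF m(2,3)] quad_pt[OF 1(2,3)] m(4)
      by (simp add: pcompose_smult pcompose_mult pcompose_pCons algebra_simps)
  qed
  with assms show ?thesis
    by (simp add: zonal_kernel_def pairing_shift degree_quad_power flip: pcompose_power)
qed

lemma zonal_kernel_scale:
  assumes "p \<in> \<Omega>" "q \<in> \<Omega>" "a \<noteq> 0" "d \<noteq> 0"
  shows "zonal_kernel m (moebius_lift (moebius a 0 0 d) p) (moebius_lift (moebius a 0 0 d) q) =
    zonal_kernel m p q"
proof -
  have "quad (moebius_lift (moebius a 0 0 d) p) = smult (a / d) (pcompose (quad p) [:0, d / a:])"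
    if "p \<in> \<Omega>" for p
    using that
  proof (cases rule: \<Omega>_cases)
    case (1 z1 z2 w1 w2)
    have det: "a * d - 0 * 0 \<noteq> 0" using assms by simp
    note m = moebius_lift_pt[OF 1(2,3) det]
    show ?thesis
      unfolding 1(1) m(1) quad_pt[OF m(2,3)] quad_pt[OF 1(2,3)] m(4)
      using assms(3,4) 1(4) by (simp add: pcompose_smult pcompose_mult pcompose_pCons field_simps)
  qed
  moreover have "((a / d) ^ m)\<^sup>2 * (d / a) ^ (2 * m) = 1"
    using assms(3,4) by (simp add: power_divide power_mult power2_eq_square field_simps)
  ultimately show ?thesis
    using assms by (simp add: zonal_kernel_def smult_power pairing_scale flip: pcompose_power)
qed

text \<open>
  Serves both the exchange of the two coordinates (\<open>e = 1\<close>) and the inversion (\<open>e = -1\<close>).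
\<close>

lemma zonal_kernel_reverse:
  assumes "\<And>p x. p \<in> \<Omega> \<Longrightarrow> x \<noteq> 0 \<Longrightarrow> poly (quad (R p)) x = x\<^sup>2 * (e * poly (quad p) (inverse x))"
    and "e\<^sup>2 = 1" "p \<in> \<Omega>" "q \<in> \<Omega>"
  shows "zonal_kernel m (R p) (R q) = zonal_kernel m p q"
proof -
  have rev: "reversal_of (2 * m) (smult (e ^ m) (quad p ^ m)) (quad (R p) ^ m)" if "p \<in> \<Omega>" for p
    using that assms(1)[OF that]
    by (intro reversal_ofI degree_quad_power order.trans[OF degree_smult_le])
       (simp_all add: poly_power power_mult_distrib power_mult)
  have "zonal_kernel m (R p) (R q) = pairing m (smult (e ^ m) (quad p ^ m)) (smult (e ^ m) (quad q ^ m))"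
    unfolding zonal_kernel_def using assms by (intro pairing_reversal rev)
  also have "\<dots> = zonal_kernel m p q"
    using pairing_scale[of "e ^ m" 1 m "quad p ^ m" "quad q ^ m"] assms(2)
    by (simp add: zonal_kernel_def pcompose_idR power_mult[symmetric] mult.commute[of m] power_mult)
  finally show ?thesis .
qed

lemma zonal_kernel_swap:
  assumes "p \<in> \<Omega>" "q \<in> \<Omega>"
  shows "zonal_kernel m (prod.swap p) (prod.swap q) = zonal_kernel m p q"
proof (rule zonal_kernel_reverse[where e = 1])
  fix p and x :: complex assume "p \<in> \<Omega>" "x \<noteq> 0"
  from this(1) show "poly (quad (prod.swap p)) x = x\<^sup>2 * (1 * poly (quad p) (inverse x))"
  proof (cases rule: \<Omega>_cases)
    case (1 z1 z2 w1 w2)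
    show ?thesis using 1 \<open>x \<noteq> 0\<close>
      by (simp add: quad_pt power2_eq_square field_simps del: mult_pCons_left mult_pCons_right)
  qed
qed (use assms in auto)

lemma zonal_kernel_inversion:
  assumes "p \<in> \<Omega>" "q \<in> \<Omega>"
  shows "zonal_kernel m (moebius_lift (moebius 0 1 1 0) p) (moebius_lift (moebius 0 1 1 0) q) =
    zonal_kernel m p q"
proof (rule zonal_kernel_reverse[where e = "-1"])
  fix p and x :: complex assume "p \<in> \<Omega>" "x \<noteq> 0"
  from this(1) show "poly (quad (moebius_lift (moebius 0 1 1 0) p)) x =
      x\<^sup>2 * (- 1 * poly (quad p) (inverse x))"
  proof (cases rule: \<Omega>_cases)
    case (1 z1 z2 w1 w2)
    have det: "0 * 0 - 1 * 1 \<noteq> (0 :: complex)" by simp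
    note m = moebius_lift_pt[OF 1(2,3) det]
    show ?thesis
      unfolding 1(1) m(1) quad_pt[OF m(2,3)] quad_pt[OF 1(2,3)] m(4)
      using \<open>x \<noteq> 0\<close> 1(4)
      by (simp add: power2_eq_square field_simps del: mult_pCons_left mult_pCons_right)
  qed
qed (use assms in auto)

text \<open>
  Translations, scalings and the inversion generate the Moebius group: a matrix with \<open>d \<noteq> 0\<close> is an
  upper unipotent matrix times a diagonal one times a lower unipotent one, a lower unipotent matrix is
  conjugate to an upper one by the inversion, and if \<open>d = 0\<close> one composes with the inversion first.
\<close>

lemma zonal_kernel_moebius:
  assumes "\<psi> \<in> moebius_transformations" "p \<in> \<Omega>" "q \<in> \<Omega>"
  shows "zonal_kernel m (moebius_lift \<psi> p) (moebius_lift \<psi> q) = zonal_kernel m p q"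
proof -
  define inv where "inv \<psi> \<longleftrightarrow> \<psi> \<in> moebius_transformations \<and> (\<forall>p\<in>\<Omega>. \<forall>q\<in>\<Omega>.
      zonal_kernel m (moebius_lift \<psi> p) (moebius_lift \<psi> q) = zonal_kernel m p q)" for \<psi>
  have comp: "inv (\<psi> \<circ> \<psi>')" if "inv \<psi>" "inv \<psi>'" for \<psi> \<psi>'
    using that unfolding inv_def
    by (auto simp: moebius_transformations_comp moebius_lift_in_\<Omega> simp flip: moebius_lift_comp)
  have MI: "a * d - b * c \<noteq> 0 \<Longrightarrow> moebius a b c d \<in> moebius_transformations" for a b c d
    by (auto simp: moebius_transformations_def)
  have trans: "inv (moebius 1 \<tau> 0 1)" for \<tau>
    by (auto simp: inv_def zonal_kernel_translate intro: MI)
  have scale: "inv (moebius a 0 0 d)" if "a \<noteq> 0" "d \<noteq> 0" for a d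
    using that by (auto simp: inv_def zonal_kernel_scale intro: MI)
  have inversion: "inv (moebius 0 1 1 0)"
    by (auto simp: inv_def zonal_kernel_inversion intro: MI)
  have lower: "inv (moebius 1 0 e 1)" for e
  proof -
    have "moebius 1 0 e 1 = moebius 0 1 1 0 \<circ> moebius 1 e 0 1 \<circ> moebius 0 1 1 0"
      by (simp add: moebius_comp)
    then show ?thesis using comp inversion trans by metis
  qed
  have generic: "inv (moebius a b c d)" if "a * d - b * c \<noteq> 0" "d \<noteq> 0" for a b c d
  proof -
    have "moebius ((a * d - b * c) / d) 0 0 d \<circ> moebius 1 0 (c / d) 1 =
        moebius ((a * d - b * c) / d) 0 c d"
      using that by (subst moebius_comp) auto
    moreover have "moebius 1 (b / d) 0 1 \<circ> moebius ((a * d - b * c) / d) 0 c d = moebius a b c d"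
      using that by (subst moebius_comp) (auto simp: field_simps)
    ultimately show ?thesis
      using comp[OF trans[of "b / d"] comp[OF scale[of "(a * d - b * c) / d" d] lower[of "c / d"]]] that
      by simp
  qed
  obtain a b c d where \<psi>: "\<psi> = moebius a b c d" and det: "a * d - b * c \<noteq> 0"
    using assms(1) by (auto simp: moebius_transformations_def)
  have "inv \<psi>"
  proof (cases "d = 0")
    case False
    then show ?thesis using generic det \<psi> by blast
  next
    case True
    then have "b \<noteq> 0" "c \<noteq> 0" using det by auto
    then have "inv (moebius b a 0 c)" by (intro generic) auto
    from comp[OF this inversion] \<open>b \<noteq> 0\<close> \<open>c \<noteq> 0\<close> show ?thesis
      unfolding \<psi> True by (subst (asm) moebius_comp) auto
  qed
  with assms show ?thesis by (simp add: inv_def)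
qed

lemma zonal_kernel_invariant:
  assumes "S \<in> moebius_group_\<Omega>" "p \<in> \<Omega>" "q \<in> \<Omega>"
  shows "zonal_kernel m (S p) (S q) = zonal_kernel m p q"
  using assms unfolding moebius_group_\<Omega>_eq
  by (auto simp: zonal_kernel_moebius zonal_kernel_swap swap_in_\<Omega> simp del: swap_simp)

section \<open>Holomorphic functions on \<Omega>\<close>

text \<open>
  The pointwise condition in \<open>holomorphic2_on\<close>, for which the usual rules are derived.
\<close>

definition cdiff2 :: "(complex \<times> complex \<Rightarrow> complex) \<Rightarrow> complex \<times> complex \<Rightarrow> bool" where
  "cdiff2 f p \<longleftrightarrow> (\<exists>a b. (f has_derivative (\<lambda>(h, k). a * h + b * k)) (at p))"

lemma cdiff2I:
  assumes "(f has_derivative f') (at p)" "\<And>h k. f' (h, k) = a * h + b * k"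
  shows "cdiff2 f p"
proof -
  have "f' = (\<lambda>(h, k). a * h + b * k)" using assms(2) by auto
  with assms(1) show ?thesis by (auto simp: cdiff2_def)
qed

lemma cdiff2E:
  assumes "cdiff2 f p"
  obtains f' a b where "(f has_derivative f') (at p)" "\<And>h k. f' (h, k) = a * h + b * k"
  using assms by (auto simp: cdiff2_def)

lemma cdiff2_isCont: "cdiff2 f p \<Longrightarrow> isCont f p"
  unfolding cdiff2_def using has_derivative_continuous by blast

lemma cdiff2_const: "cdiff2 (\<lambda>x. c) p"
  by (rule cdiff2I[where a = 0 and b = 0], rule has_derivative_const) auto

lemma cdiff2_fst: "cdiff2 fst p"
  by (rule cdiff2I[where a = 1 and b = 0], rule has_derivative_fst[OF has_derivative_ident]) auto

lemma cdiff2_snd: "cdiff2 snd p"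
  by (rule cdiff2I[where a = 0 and b = 1], rule has_derivative_snd[OF has_derivative_ident]) auto

lemma cdiff2_add:
  assumes "cdiff2 f p" "cdiff2 g p"
  shows "cdiff2 (\<lambda>x. f x + g x) p"
proof -
  obtain f' a b where f: "(f has_derivative f') (at p)" "\<And>h k. f' (h, k) = a * h + b * k"
    using assms(1) by (rule cdiff2E) blast
  obtain g' c d where g: "(g has_derivative g') (at p)" "\<And>h k. g' (h, k) = c * h + d * k"
    using assms(2) by (rule cdiff2E) blast
  show ?thesis
    by (rule cdiff2I[OF has_derivative_add[OF f(1) g(1)], of "a + c" "b + d"])
      (simp add: f g algebra_simps)
qed

lemma cdiff2_mult:
  assumes "cdiff2 f p" "cdiff2 g p"
  shows "cdiff2 (\<lambda>x. f x * g x) p"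
proof -
  obtain f' a b where f: "(f has_derivative f') (at p)" "\<And>h k. f' (h, k) = a * h + b * k"
    using assms(1) by (rule cdiff2E) blast
  obtain g' c d where g: "(g has_derivative g') (at p)" "\<And>h k. g' (h, k) = c * h + d * k"
    using assms(2) by (rule cdiff2E) blast
  show ?thesis
    by (rule cdiff2I[OF has_derivative_mult[OF f(1) g(1)], of "f p * c + a * g p" "f p * d + b * g p"])
      (simp add: f g algebra_simps)
qed

lemma cdiff2_sum: "(\<And>i. i \<in> I \<Longrightarrow> cdiff2 (f i) p) \<Longrightarrow> cdiff2 (\<lambda>x. \<Sum>i\<in>I. f i x) p"
  by (induction I rule: infinite_finite_induct) (simp_all add: cdiff2_const cdiff2_add)

lemma cdiff2_compose:
  assumes "cdiff2 f p" "(h has_field_derivative h') (at (f p))"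
  shows "cdiff2 (\<lambda>x. h (f x)) p"
proof -
  obtain f' a b where f: "(f has_derivative f') (at p)" "\<And>h k. f' (h, k) = a * h + b * k"
    using assms(1) by (rule cdiff2E) blast
  show ?thesis
    by (rule cdiff2I[OF has_derivative_compose[OF f(1) assms(2)[unfolded has_field_derivative_def]],
          of "h' * a" "h' * b"]) (simp add: f algebra_simps)
qed

lemma cdiff2_divide:
  assumes "cdiff2 f p" "cdiff2 g p" "g p \<noteq> 0"
  shows "cdiff2 (\<lambda>x. f x / g x) p"
  unfolding divide_inverse
  by (rule cdiff2_mult[OF assms(1) cdiff2_compose[OF assms(2) DERIV_inverse[OF assms(3)]]])

lemma cdiff2_compose2:
  assumes "cdiff2 f p" "cdiff2 g p" "cdiff2 H (f p, g p)"
  shows "cdiff2 (\<lambda>x. H (f x, g x)) p"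
proof -
  obtain f' a b where f: "(f has_derivative f') (at p)" "\<And>h k. f' (h, k) = a * h + b * k"
    using assms(1) by (rule cdiff2E) blast
  obtain g' c d where g: "(g has_derivative g') (at p)" "\<And>h k. g' (h, k) = c * h + d * k"
    using assms(2) by (rule cdiff2E) blast
  obtain H' u v where H: "(H has_derivative H') (at (f p, g p))" "\<And>h k. H' (h, k) = u * h + v * k"
    using assms(3) by (rule cdiff2E) blast
  show ?thesis
    by (rule cdiff2I[OF has_derivative_compose[OF has_derivative_Pair[OF f(1) g(1)] H(1)],
          of "u * a + v * c" "u * b + v * d"]) (simp add: f g H algebra_simps)
qed

lemma cdiff2_cong:
  assumes "cdiff2 f p" "\<forall>\<^sub>F x in nhds p. f x = g x"
  shows "cdiff2 g p"
proof -
  have "\<forall>\<^sub>F x in at p. f x = g x" "f p = g p"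
    using assms(2) eventually_nhds_x_imp_x[OF assms(2)]
    by (auto simp: eventually_at_filter elim: eventually_mono)
  then show ?thesis
    using assms(1) has_derivative_transform_eventually[of f _ p UNIV g] unfolding cdiff2_def by blast
qed

lemma hol_\<Omega>_iff:
  "F \<in> hol_\<Omega> \<longleftrightarrow> (\<forall>\<phi>\<in>sphere_charts. \<forall>\<psi>\<in>sphere_charts. \<forall>s t.
     (\<phi> s, \<psi> t) \<in> \<Omega> \<longrightarrow> cdiff2 (\<lambda>x. F (\<phi> (fst x), \<psi> (snd x))) (s, t))"
  by (simp add: hol_\<Omega>_def holomorphic2_on_def cdiff2_def case_prod_unfold)

text \<open>
  Introduction rule that treats the four product charts at once: in each of them the points of \<open>\<Omega>\<close>
  are given by holomorphic homogeneous coordinates without common zeros.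
\<close>

lemma hol_\<Omega>I:
  assumes "\<And>z1 z2 w1 w2 p. (\<And>x. cdiff2 z1 x) \<Longrightarrow> (\<And>x. cdiff2 z2 x) \<Longrightarrow>
      (\<And>x. cdiff2 w1 x) \<Longrightarrow> (\<And>x. cdiff2 w2 x) \<Longrightarrow>
      (\<And>x. z1 x \<noteq> 0 \<or> z2 x \<noteq> 0) \<Longrightarrow> (\<And>x. w1 x \<noteq> 0 \<or> w2 x \<noteq> 0) \<Longrightarrow>
      (pt (z1 p) (z2 p), pt (w1 p) (w2 p)) \<in> \<Omega> \<Longrightarrow>
      cdiff2 (\<lambda>x. F (pt (z1 x) (z2 x), pt (w1 x) (w2 x))) p"
  shows "F \<in> hol_\<Omega>"
proof -
  define charts :: "((complex \<Rightarrow> complex) \<times> (complex \<Rightarrow> complex)) set"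
    where "charts = {(\<lambda>s. s, \<lambda>s. 1), (\<lambda>s. 1, \<lambda>s. s)}"
  have chart: "\<exists>c\<in>charts. \<phi> = (\<lambda>s. pt (fst c s) (snd c s))" if "\<phi> \<in> sphere_charts" for \<phi>
    using that by (simp add: sphere_charts_def charts_def inverse_Fin_eq_pt Fin_eq_pt[symmetric]
        del: sphere_inverse.simps)
  have ne: "fst c s \<noteq> 0 \<or> snd c s \<noteq> 0" if "c \<in> charts" for c s
    using that by (auto simp: charts_def)
  have cd: "cdiff2 (\<lambda>x. fst c (fst x)) y" "cdiff2 (\<lambda>x. snd c (fst x)) y"
    "cdiff2 (\<lambda>x. fst c (snd x)) y" "cdiff2 (\<lambda>x. snd c (snd x)) y" if "c \<in> charts" for c y
    using that cdiff2_fst[of y] cdiff2_snd[of y] by (auto simp: cdiff2_const charts_def)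
  show ?thesis
    unfolding hol_\<Omega>_iff
  proof (intro ballI allI impI)
    fix \<phi> \<psi> s t assume "\<phi> \<in> sphere_charts" "\<psi> \<in> sphere_charts" and \<Omega>: "(\<phi> s, \<psi> t) \<in> \<Omega>"
    then obtain c d where c: "c \<in> charts" "\<phi> = (\<lambda>s. pt (fst c s) (snd c s))"
      and d: "d \<in> charts" "\<psi> = (\<lambda>s. pt (fst d s) (snd d s))"
      using chart by metis
    from assms[OF cd(1,2)[OF c(1)] cd(3,4)[OF d(1)] ne[OF c(1)] ne[OF d(1)], of "(s, t)"] \<Omega>
    show "cdiff2 (\<lambda>x. F (\<phi> (fst x), \<psi> (snd x))) (s, t)"
      by (simp only: c(2) d(2) fst_conv snd_conv)
  qed
qed

text \<open>
  Conversely, a function in \<open>hol_\<Omega>\<close> may be composed with arbitrary holomorphic homogeneous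
  coordinates, because near a given point one of the two coordinates can be divided out.
\<close>

lemma hol_\<Omega>_compose_pt:
  assumes F: "F \<in> hol_\<Omega>"
    and d: "cdiff2 z1 p" "cdiff2 z2 p" "cdiff2 w1 p" "cdiff2 w2 p"
    and ne: "z1 p \<noteq> 0 \<or> z2 p \<noteq> 0" "w1 p \<noteq> 0 \<or> w2 p \<noteq> 0"
    and \<Omega>: "(pt (z1 p) (z2 p), pt (w1 p) (w2 p)) \<in> \<Omega>"
  shows "cdiff2 (\<lambda>x. F (pt (z1 x) (z2 x), pt (w1 x) (w2 x))) p"
proof -
  have chart: "\<exists>\<phi>\<in>sphere_charts. \<exists>f. cdiff2 f p \<and> (\<forall>\<^sub>F x in nhds p. pt (n x) (d x) = \<phi> (f x))"
    if "cdiff2 n p" "cdiff2 d p" "n p \<noteq> 0 \<or> d p \<noteq> 0" for n d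
  proof -
    have ev: "\<forall>\<^sub>F x in nhds p. f x \<noteq> 0" if "cdiff2 f p" "f p \<noteq> 0" for f
      using topological_tendstoD[of f "f p" "nhds p" "- {0}"] cdiff2_isCont[OF that(1)] that(2)
      by (simp add: isCont_def tendsto_at_iff_tendsto_nhds open_Compl)
    show ?thesis
    proof (cases "d p = 0")
      case False
      have "\<forall>\<^sub>F x in nhds p. pt (n x) (d x) = Fin (n x / d x)"
        using ev[OF that(2) False] by eventually_elim (simp add: pt_def)
      then show ?thesis
        using cdiff2_divide[OF that(1,2) False]
        by (intro bexI[of _ Fin] exI[of _ "\<lambda>x. n x / d x"] conjI) (simp_all add: sphere_charts_def)
    next
      case True
      then have "n p \<noteq> 0" using that(3) by simp
      have "\<forall>\<^sub>F x in nhds p. pt (n x) (d x) = sphere_inverse (Fin (d x / n x))"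
        using ev[OF that(1) \<open>n p \<noteq> 0\<close>] by eventually_elim (simp add: pt_def)
      then show ?thesis
        using cdiff2_divide[OF that(2,1) \<open>n p \<noteq> 0\<close>]
        by (intro bexI[of _ "\<lambda>s. sphere_inverse (Fin s)"] exI[of _ "\<lambda>x. d x / n x"] conjI)
          (simp_all add: sphere_charts_def)
    qed
  qed
  obtain \<phi> f where f: "\<phi> \<in> sphere_charts" "cdiff2 f p" "\<forall>\<^sub>F x in nhds p. pt (z1 x) (z2 x) = \<phi> (f x)"
    using chart[OF d(1,2) ne(1)] by (elim bexE exE conjE) (rule that; assumption)
  obtain \<psi> g where g: "\<psi> \<in> sphere_charts" "cdiff2 g p" "\<forall>\<^sub>F x in nhds p. pt (w1 x) (w2 x) = \<psi> (g x)"
    using chart[OF d(3,4) ne(2)] by (elim bexE exE conjE) (rule that; assumption)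
  have "(\<phi> (f p), \<psi> (g p)) \<in> \<Omega>"
    using \<Omega> eventually_nhds_x_imp_x[OF f(3)] eventually_nhds_x_imp_x[OF g(3)] by simp
  then have "cdiff2 (\<lambda>x. F (\<phi> (fst x), \<psi> (snd x))) (f p, g p)"
    using F f(1) g(1) by (auto simp: hol_\<Omega>_iff)
  from cdiff2_compose2[OF f(2) g(2) this]
  have "cdiff2 (\<lambda>x. F (\<phi> (f x), \<psi> (g x))) p" by simp
  then show ?thesis
    by (rule cdiff2_cong) (use f(3) g(3) in \<open>eventually_elim, simp\<close>)
qed

lemma hol_\<Omega>_const: "(\<lambda>p. c) \<in> hol_\<Omega>"
  by (simp add: hol_\<Omega>_iff cdiff2_const)

lemma hol_\<Omega>_add: "F \<in> hol_\<Omega> \<Longrightarrow> G \<in> hol_\<Omega> \<Longrightarrow> (\<lambda>p. F p + G p) \<in> hol_\<Omega>"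
  by (auto simp: hol_\<Omega>_iff intro!: cdiff2_add)

lemma hol_\<Omega>_mult: "F \<in> hol_\<Omega> \<Longrightarrow> G \<in> hol_\<Omega> \<Longrightarrow> (\<lambda>p. F p * G p) \<in> hol_\<Omega>"
  by (auto simp: hol_\<Omega>_iff intro!: cdiff2_mult)

lemma hol_\<Omega>_sum: "(\<And>i. i \<in> I \<Longrightarrow> F i \<in> hol_\<Omega>) \<Longrightarrow> (\<lambda>p. \<Sum>i\<in>I. F i p) \<in> hol_\<Omega>"
  by (induction I rule: infinite_finite_induct) (simp_all add: hol_\<Omega>_const hol_\<Omega>_add)

lemma hol_\<Omega>_compose_entire:
  assumes "F \<in> hol_\<Omega>" "h holomorphic_on UNIV"
  shows "(\<lambda>p. h (F p)) \<in> hol_\<Omega>"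
  unfolding hol_\<Omega>_iff
proof (intro ballI allI impI)
  fix \<phi> \<psi> s t assume "\<phi> \<in> sphere_charts" "\<psi> \<in> sphere_charts" "(\<phi> s, \<psi> t) \<in> \<Omega>"
  then have "cdiff2 (\<lambda>x. F (\<phi> (fst x), \<psi> (snd x))) (s, t)"
    using assms(1) by (auto simp: hol_\<Omega>_iff)
  then show "cdiff2 (\<lambda>x. h (F (\<phi> (fst x), \<psi> (snd x)))) (s, t)"
    by (rule cdiff2_compose[OF _ holomorphic_derivI[OF assms(2) open_UNIV UNIV_I]])
qed

lemma hol_\<Omega>_moebius_lift:
  assumes "F \<in> hol_\<Omega>" "\<psi> \<in> moebius_transformations"
  shows "(\<lambda>p. F (moebius_lift \<psi> p)) \<in> hol_\<Omega>"
proof -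
  obtain a b c d where \<psi>: "\<psi> = moebius a b c d" and det: "a * d - b * c \<noteq> 0"
    using assms(2) by (auto simp: moebius_transformations_def)
  show ?thesis
  proof (rule hol_\<Omega>I, goal_cases)
    case (1 z1 z2 w1 w2 p)
    note m = moebius_lift_pt[OF 1(5) 1(6) det]
    show ?case
      unfolding \<psi> m(1)
    proof (intro hol_\<Omega>_compose_pt assms m(2,3))
      show "(pt (a * z1 p + b * z2 p) (c * z1 p + d * z2 p), pt (c * w2 p + d * w1 p) (a * w2 p + b * w1 p)) \<in> \<Omega>"
        using moebius_lift_in_\<Omega>[OF 1(7) assms(2)] by (simp add: \<psi> m(1))
    qed (intro cdiff2_add cdiff2_mult cdiff2_const 1)+
  qed
qed

lemma coeff_quad_hol_\<Omega>: "(\<lambda>p. coeff (quad p) j) \<in> hol_\<Omega>"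
proof (rule hol_\<Omega>I, goal_cases)
  case (1 z1 z2 w1 w2 p)
  define a where "a i x = coeff [:z1 x, z2 x:] i" for i x
  define b where "b i x = coeff [:w2 x, w1 x:] i" for i x
  have "cdiff2 (a i) p" "cdiff2 (b i) p" for i
    unfolding a_def b_def using 1(1-4)[of p]
    by (cases i; cases "i - 1"; simp add: coeff_pCons cdiff2_const)+
  moreover have "z2 p * w2 p + (-1) * (z1 p * w1 p) \<noteq> 0"
    using 1(7) \<Omega>_pt_iff[OF 1(5) 1(6)] by simp
  ultimately have
    "cdiff2 (\<lambda>x. 1 / (z2 x * w2 x + (-1) * (z1 x * w1 x)) * (\<Sum>i\<le>j. a i x * b (j - i) x)) p"
    by (intro cdiff2_mult cdiff2_divide cdiff2_const cdiff2_add cdiff2_sum 1) auto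
  moreover have "coeff (quad (pt (z1 x) (z2 x), pt (w1 x) (w2 x))) j =
     1 / (z2 x * w2 x + (-1) * (z1 x * w1 x)) * (\<Sum>i\<le>j. a i x * b (j - i) x)" for x
    unfolding quad_pt[OF 1(5) 1(6)] coeff_smult coeff_mult a_def b_def
    by (simp add: inverse_eq_divide)
  ultimately show ?case by simp
qed

lemma coeff_quad_power_hol_\<Omega>: "(\<lambda>p. coeff (quad p ^ m) j) \<in> hol_\<Omega>"
proof (induction m arbitrary: j)
  case 0
  show ?case by (simp add: hol_\<Omega>_const)
next
  case (Suc m)
  show ?case
    unfolding power_Suc coeff_mult
    by (intro hol_\<Omega>_sum hol_\<Omega>_mult coeff_quad_hol_\<Omega> Suc)
qed

lemma zonal_kernel_hol_\<Omega>: "(\<lambda>p. zonal_kernel m p q) \<in> hol_\<Omega>"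
  unfolding zonal_kernel_def pairing_def
  by (intro hol_\<Omega>_sum hol_\<Omega>_mult hol_\<Omega>_const coeff_quad_power_hol_\<Omega>)

section \<open>The Laplacian of the zonal kernel\<close>

text \<open>
  The Laplacian is a holomorphic extension, so its values at infinite points, and even that the
  extension exists, are known only once a function \<open>G\<close> on \<open>\<Omega>\<close> is at hand that continues the
  formula valid at finite points.
\<close>

lemma laplacian_eqI:
  assumes G: "G \<in> hol_\<Omega>"
    and f: "\<And>z w. z * w \<noteq> 1 \<Longrightarrow> F (Fin z, Fin w) = f z w"
    and g: "\<And>z w. z * w \<noteq> 1 \<Longrightarrow> (f z has_field_derivative g z w) (at w)"
    and k: "\<And>z w. z * w \<noteq> 1 \<Longrightarrow> ((\<lambda>z. g z w) has_field_derivative k z w) (at z)"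
    and eq: "\<And>z w. z * w \<noteq> 1 \<Longrightarrow> 4 * (1 - z * w)\<^sup>2 * k z w = G (Fin z, Fin w)"
    and p: "p \<in> \<Omega>"
  shows "laplacian F p = G p"
  unfolding laplacian_def
proof (rule hol_ext_eq[OF G _ p])
  fix z w assume "(Fin z, Fin w) \<in> \<Omega>"
  then have zw: "z * w \<noteq> 1" by (simp add: Fin_in_\<Omega>_iff)
  have inner: "deriv (\<lambda>w'. F (Fin z', Fin w')) w = g z' w" if "z' * w \<noteq> 1" for z'
  proof (rule DERIV_imp_deriv)
    have "open {w'. z' * w' \<noteq> 1}" by (intro open_Collect_neq continuous_intros)
    then show "((\<lambda>w'. F (Fin z', Fin w')) has_field_derivative g z' w) (at w)"
      by (rule has_field_derivative_transform_within_open[OF g[OF that]]) (use that f in auto)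
  qed
  have "deriv (\<lambda>z'. deriv (\<lambda>w'. F (Fin z', Fin w')) w) z = k z w"
  proof (rule DERIV_imp_deriv)
    have "open {z'. z' * w \<noteq> 1}" by (intro open_Collect_neq continuous_intros)
    then show "((\<lambda>z'. deriv (\<lambda>w'. F (Fin z', Fin w')) w) has_field_derivative k z w) (at z)"
      by (rule has_field_derivative_transform_within_open[OF k[OF zw]]) (use zw inner in auto)
  qed
  then show "G (Fin z, Fin w) =
      4 * (1 - z * w)\<^sup>2 * deriv (\<lambda>z'. deriv (\<lambda>w'. F (Fin z', Fin w')) w) z"
    using eq[OF zw] by simp
qed

lemma poly_eqI_complex: "(\<And>x. poly p x = poly q x) \<Longrightarrow> p = q" for p q :: "complex poly"
  by (simp add: poly_eq_poly_eq_iff[symmetric] fun_eq_iff)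

text \<open>
  The derivative of a polynomial that depends on a parameter, with respect to the parameter.
\<close>

definition coeffwise_deriv :: "(complex \<Rightarrow> complex poly) \<Rightarrow> complex poly \<Rightarrow> complex \<Rightarrow> bool" where
  "coeffwise_deriv P P' \<tau> \<longleftrightarrow>
     (\<forall>j. ((\<lambda>\<tau>. coeff (P \<tau>) j) has_field_derivative coeff P' j) (at \<tau>))"

lemma coeffwise_deriv_const: "coeffwise_deriv (\<lambda>\<tau>. P) 0 \<tau>"
  by (simp add: coeffwise_deriv_def)

lemma coeffwise_deriv_linear:
  assumes "(a has_field_derivative a') (at \<tau>)" "(b has_field_derivative b') (at \<tau>)"
  shows "coeffwise_deriv (\<lambda>\<tau>. [:a \<tau>, b \<tau>:]) [:a', b':] \<tau>"
  using assms by (simp add: coeffwise_deriv_def coeff_pCons split: nat.split)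

lemma coeffwise_deriv_mult:
  assumes "coeffwise_deriv P P' \<tau>" "coeffwise_deriv Q Q' \<tau>"
  shows "coeffwise_deriv (\<lambda>\<tau>. P \<tau> * Q \<tau>) (P' * Q \<tau> + P \<tau> * Q') \<tau>"
  unfolding coeffwise_deriv_def coeff_mult coeff_add
  using assms unfolding coeffwise_deriv_def
  by (auto intro!: derivative_eq_intros simp: sum.distrib algebra_simps)

lemma coeffwise_deriv_smult:
  assumes "(c has_field_derivative c') (at \<tau>)" "coeffwise_deriv P P' \<tau>"
  shows "coeffwise_deriv (\<lambda>\<tau>. smult (c \<tau>) (P \<tau>)) (smult c' (P \<tau>) + smult (c \<tau>) P') \<tau>"
  using assms unfolding coeffwise_deriv_def
  by (auto intro!: derivative_eq_intros)

lemma coeffwise_deriv_power: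
  assumes "coeffwise_deriv P P' \<tau>"
  shows "coeffwise_deriv (\<lambda>\<tau>. P \<tau> ^ n) (of_nat n * P \<tau> ^ (n - 1) * P') \<tau>"
proof (induction n)
  case 0
  show ?case by (simp add: coeffwise_deriv_const)
next
  case (Suc n)
  have "P' * P \<tau> ^ n + P \<tau> * (of_nat n * P \<tau> ^ (n - 1) * P') =
      of_nat (Suc n) * P \<tau> ^ (Suc n - 1) * P'"
    by (cases n) (simp_all add: algebra_simps)
  then show ?case using coeffwise_deriv_mult[OF assms Suc] by simp
qed

lemma pairing_coeffwise_deriv:
  assumes "coeffwise_deriv P P' \<tau>"
  shows "((\<lambda>\<tau>. pairing m (P \<tau>) Q) has_field_derivative pairing m P' Q) (at \<tau>)"
  using assms unfolding pairing_def coeffwise_deriv_def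
  by (intro DERIV_sum DERIV_cmult DERIV_cmult_right) blast

lemma pairing_smult_left: "pairing m (smult c P) Q = c * pairing m P Q"
  unfolding pairing_def sum_distrib_left by (intro sum.cong) simp_all

text \<open>
  Every coefficient of \<open>quad\<^sup>m = s\<^sup>m U\<^sup>m V\<^sup>m\<close>, with \<open>s = 1 / (1 - z w)\<close>, \<open>U = z + x\<close> and \<open>V = 1 + w x\<close>,
  is an eigenfunction.  Indeed, \<open>s z V + x = s U\<close> gives
  \<open>\<partial>\<^sub>w (s\<^sup>m U\<^sup>m V\<^sup>m) = m s\<^sup>m\<^sup>+\<^sup>1 U\<^sup>m\<^sup>+\<^sup>1 V\<^sup>m\<^sup>-\<^sup>1\<close>, and \<open>s w U + 1 = s V\<close> gives
  \<open>\<partial>\<^sub>z (s\<^sup>m\<^sup>+\<^sup>1 U\<^sup>m\<^sup>+\<^sup>1 V\<^sup>m\<^sup>-\<^sup>1) = (m + 1) s\<^sup>m\<^sup>+\<^sup>2 U\<^sup>m V\<^sup>m\<close>; the factor \<open>s\<^sup>2\<close> is cancelled by \<open>(1 - z w)\<^sup>2\<close>.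
  The statement asks for \<open>F\<close> at finite points only and thus applies directly to the zonal harmonic,
  which is a multiple of the kernel on \<open>\<Omega>\<close>.
\<close>

lemma zonal_kernel_laplacian:
  assumes "p \<in> \<Omega>" "\<And>z w. z * w \<noteq> 1 \<Longrightarrow> F (Fin z, Fin w) = c * zonal_kernel m (Fin z, Fin w) q"
  shows "laplacian F p = 4 * of_nat m * (of_nat m + 1) * (c * zonal_kernel m p q)"
proof (cases m)
  case 0
  have "F (Fin z, Fin w) = c * pairing 0 1 1" if "z * w \<noteq> 1" for z w
    using assms(2)[OF that] by (simp add: 0 zonal_kernel_def)
  then have "laplacian F p = 0"
    by (intro laplacian_eqI[where f = "\<lambda>_ _. c * pairing 0 1 1" and g = "\<lambda>_ _. 0" and k = "\<lambda>_ _. 0"])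
      (auto simp: hol_\<Omega>_const assms(1))
  then show ?thesis by (simp add: 0)
next
  case (Suc n)
  define Q where "Q = quad q ^ m"
  define s U V where "s z w = inverse (1 - z * w)" and "U z = [:z, 1:]" and "V w = [:1, w:]"
    for z w :: complex
  note defs = this
  have quad: "quad (Fin z, Fin w) ^ m = smult (s z w ^ Suc n) (U z ^ Suc n * V w ^ Suc n)" for z w
    unfolding quad_Fin Suc by (simp only: smult_power power_mult_distrib defs)
  define f where "f z w = c * zonal_kernel m (Fin z, Fin w) q" for z w
  define P1 where "P1 z w = smult (of_nat m * s z w ^ (n + 2)) (U z ^ (n + 2) * V w ^ n)" for z w
  define P2 where "P2 z w = smult (of_nat m * (of_nat m + 1) * s z w ^ (n + 3)) (U z ^ (n + 1) * V w ^ (n + 1))"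
    for z w
  have f: "f z w = c * pairing m (smult (s z w ^ Suc n) (U z ^ Suc n * V w ^ Suc n)) Q" for z w
    by (simp only: f_def zonal_kernel_def quad Q_def)
  have sw: "(s z has_field_derivative z * (s z w)\<^sup>2) (at w)"
    and sz: "((\<lambda>z. s z w) has_field_derivative w * (s z w)\<^sup>2) (at z)" if "z * w \<noteq> 1" for z w
    unfolding defs using that by (auto intro!: derivative_eq_intros simp: power2_eq_square)
  have Vw: "coeffwise_deriv V [:0, 1:] w" for w
    unfolding defs by (rule coeffwise_deriv_linear) (auto intro!: derivative_eq_intros)
  have Uz: "coeffwise_deriv U [:1, 0:] z" for z
    unfolding defs by (rule coeffwise_deriv_linear) (auto intro!: derivative_eq_intros)
  have power: "((\<lambda>t. g t ^ Suc k) has_field_derivative of_nat (Suc k) * (D * g t ^ k)) (at t)"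
    if "(g has_field_derivative D) (at t)" for g :: "complex \<Rightarrow> complex" and D t k
    using DERIV_power_Suc[OF that, of k] by simp
  have inv: "s z w * (1 - z * w) = 1" if "z * w \<noteq> 1" for z w
    using that by (simp add: defs)
  have dw: "coeffwise_deriv (\<lambda>w. smult (s z w ^ Suc n) (U z ^ Suc n * V w ^ Suc n)) (P1 z w) w"
    if zw: "z * w \<noteq> 1" for z w
  proof -
    have "coeffwise_deriv (\<lambda>w. smult (s z w ^ Suc n) (U z ^ Suc n * V w ^ Suc n))
      (smult (of_nat (Suc n) * (z * (s z w)\<^sup>2 * s z w ^ n)) (U z ^ Suc n * V w ^ Suc n)
      + smult (s z w ^ Suc n) (0 * V w ^ Suc n + U z ^ Suc n * (of_nat (Suc n) * V w ^ (Suc n - 1) * [:0, 1:]))) w"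
      by (intro coeffwise_deriv_smult coeffwise_deriv_mult coeffwise_deriv_const coeffwise_deriv_power Vw
          power sw zw)
    also have "(smult (of_nat (Suc n) * (z * (s z w)\<^sup>2 * s z w ^ n)) (U z ^ Suc n * V w ^ Suc n)
      + smult (s z w ^ Suc n) (0 * V w ^ Suc n + U z ^ Suc n * (of_nat (Suc n) * V w ^ (Suc n - 1) * [:0, 1:])))
      = P1 z w" (is "?A = _")
    proof (rule poly_eqI_complex)
      fix x
      define u v \<sigma> N where "u = z + x" "v = 1 + x * w" "\<sigma> = s z w" "N = (of_nat (Suc n) :: complex)"
      have \<sigma>: "\<sigma> * (1 - z * w) = 1" using inv[OF zw] by (simp add: u_v_\<sigma>_N_def)
      have "\<sigma> * z * v + x = \<sigma> * u + x * (1 - \<sigma> * (1 - z * w))"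
        by (simp add: u_v_\<sigma>_N_def algebra_simps)
      then have *: "\<sigma> * z * v + x = \<sigma> * u" by (simp add: \<sigma>)
      have "poly ?A x = N * (z * \<sigma>\<^sup>2 * \<sigma> ^ n) * (u ^ Suc n * v ^ Suc n) + \<sigma> ^ Suc n * (u ^ Suc n * (N * v ^ n * x))"
        by (simp add: u_v_\<sigma>_N_def defs(2,3) poly_power poly_of_nat algebra_simps)
      also have "\<dots> = N * \<sigma> ^ Suc n * u ^ Suc n * v ^ n * (\<sigma> * z * v + x)"
        by (simp add: algebra_simps power2_eq_square)
      also have "\<dots> = poly (P1 z w) x"
        unfolding * by (simp add: u_v_\<sigma>_N_def P1_def defs(2,3) poly_power Suc algebra_simps)
      finally show "poly ?A x = poly (P1 z w) x" .
    qed
    finally show ?thesis .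
  qed
  have dz: "coeffwise_deriv (\<lambda>z. P1 z w) (P2 z w) z"
    if zw: "z * w \<noteq> 1" for z w
  proof -
    have "coeffwise_deriv (\<lambda>z. P1 z w)
      (smult (of_nat m * (of_nat (Suc (Suc n)) * (w * (s z w)\<^sup>2 * s z w ^ Suc n))) (U z ^ Suc (Suc n) * V w ^ n)
      + smult (of_nat m * s z w ^ Suc (Suc n))
          ((of_nat (Suc (Suc n)) * U z ^ (Suc (Suc n) - 1) * [:1, 0:]) * V w ^ n + U z ^ Suc (Suc n) * 0)) z"
      unfolding P1_def add_2_eq_Suc'
      by (intro coeffwise_deriv_smult coeffwise_deriv_mult coeffwise_deriv_const coeffwise_deriv_power Uz
          DERIV_cmult power sz zw)
    also have "(smult (of_nat m * (of_nat (Suc (Suc n)) * (w * (s z w)\<^sup>2 * s z w ^ Suc n))) (U z ^ Suc (Suc n) * V w ^ n)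
      + smult (of_nat m * s z w ^ Suc (Suc n))
          ((of_nat (Suc (Suc n)) * U z ^ (Suc (Suc n) - 1) * [:1, 0:]) * V w ^ n + U z ^ Suc (Suc n) * 0))
      = P2 z w" (is "?A = _")
    proof (rule poly_eqI_complex)
      fix x
      define u v \<sigma> N where "u = z + x" "v = 1 + x * w" "\<sigma> = s z w" "N = (of_nat (Suc (Suc n)) :: complex)"
      have \<sigma>: "\<sigma> * (1 - z * w) = 1" using inv[OF zw] by (simp add: u_v_\<sigma>_N_def)
      have "\<sigma> * w * u + 1 = \<sigma> * v + (1 - \<sigma> * (1 - z * w))"
        by (simp add: u_v_\<sigma>_N_def algebra_simps)
      then have *: "\<sigma> * w * u + 1 = \<sigma> * v" by (simp add: \<sigma>)
      have "poly ?A x = of_nat m * (N * (w * \<sigma>\<^sup>2 * \<sigma> ^ Suc n)) * (u ^ Suc (Suc n) * v ^ n)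
          + of_nat m * \<sigma> ^ Suc (Suc n) * (N * u ^ Suc n * v ^ n)"
        by (simp add: u_v_\<sigma>_N_def defs(2,3) poly_power poly_of_nat algebra_simps)
      also have "\<dots> = of_nat m * N * \<sigma> ^ Suc (Suc n) * u ^ Suc n * v ^ n * (\<sigma> * w * u + 1)"
        by (simp add: algebra_simps power2_eq_square)
      also have "\<dots> = poly (P2 z w) x"
        unfolding * by (simp add: u_v_\<sigma>_N_def P2_def defs(2,3) poly_power Suc algebra_simps eval_nat_numeral)
      finally show "poly ?A x = poly (P2 z w) x" .
    qed
    finally show ?thesis .
  qed
  show ?thesis
  proof (rule laplacian_eqI[where f = f and g = "\<lambda>z w. c * pairing m (P1 z w) Q"
        and k = "\<lambda>z w. c * pairing m (P2 z w) Q"])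
    show "(\<lambda>p. 4 * of_nat m * (of_nat m + 1) * (c * zonal_kernel m p q)) \<in> hol_\<Omega>"
      by (intro hol_\<Omega>_mult hol_\<Omega>_const zonal_kernel_hol_\<Omega>)
  next
    fix z w :: complex assume zw: "z * w \<noteq> 1"
    have "(1 - z * w)\<^sup>2 * s z w ^ (n + 3) = (s z w * (1 - z * w))\<^sup>2 * s z w ^ Suc n"
      by (simp add: power2_eq_square power3_eq_cube power_add algebra_simps)
    then have "(1 - z * w)\<^sup>2 * s z w ^ (n + 3) = s z w ^ Suc n" by (simp add: inv[OF zw])
    moreover have "4 * (1 - z * w)\<^sup>2 * (c * pairing m (P2 z w) Q) =
        4 * of_nat m * (of_nat m + 1) * (c * (((1 - z * w)\<^sup>2 * s z w ^ (n + 3)) * pairing m (U z ^ Suc n * V w ^ Suc n) Q))"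
      by (simp add: P2_def pairing_smult_left algebra_simps)
    ultimately show "4 * (1 - z * w)\<^sup>2 * (c * pairing m (P2 z w) Q) =
        4 * of_nat m * (of_nat m + 1) * (c * zonal_kernel m (Fin z, Fin w) q)"
      by (simp only: zonal_kernel_def quad pairing_smult_left Q_def)
  next
    fix z w :: complex assume zw: "z * w \<noteq> 1"
    show "(f z has_field_derivative c * pairing m (P1 z w) Q) (at w)"
      unfolding f[abs_def] by (intro DERIV_cmult pairing_coeffwise_deriv dw zw)
    show "((\<lambda>z. c * pairing m (P1 z w) Q) has_field_derivative c * pairing m (P2 z w) Q) (at z)"
      by (intro DERIV_cmult pairing_coeffwise_deriv dz zw)
  qed (use assms f_def in auto)
qed

section \<open>The zonal harmonic as a pairing of forms\<close>

text \<open>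
  Up to sign these coefficients are the Poisson modes of index \<open>n\<close> and \<open>-n\<close>: \<open>quad\<^sup>m\<close> is their
  generating function.
\<close>

lemma coeff_quad_Fin_power:
  assumes zw: "z * w \<noteq> 1" and n: "n \<le> m"
  shows "coeff (quad (Fin z, Fin w) ^ m) (m + n) =
      (\<Sum>k\<le>m - n. of_nat (m choose (k + n)) * of_nat (m choose k) * z ^ k * w ^ (k + n)) / (1 - z * w) ^ m"
    and "coeff (quad (Fin z, Fin w) ^ m) (m - n) =
      (\<Sum>k\<le>m - n. of_nat (m choose (k + n)) * of_nat (m choose k) * z ^ (k + n) * w ^ k) / (1 - z * w) ^ m"
proof -
  have U: "coeff ([:z, 1:] ^ m) i = of_nat (m choose i) * z ^ (m - i)" for i
    using coeff_linear_poly_power[of i m z 1]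
    by (cases "i \<le> m") (simp_all add: coeff_eq_0 degree_linear_power binomial_eq_0)
  have V: "coeff ([:1, w:] ^ m) i = of_nat (m choose i) * w ^ i" for i
  proof (cases "i \<le> m")
    case True
    then show ?thesis by (simp add: coeff_linear_poly_power)
  next
    case False
    have "degree ([:1, w:] ^ m) \<le> m"
      using degree_power_le[of "[:1, w:]" m] degree_pCons_le[of 1 "[:w:]"] by (simp split: if_splits)
    then show ?thesis using False by (simp add: coeff_eq_0 binomial_eq_0)
  qed
  have c: "coeff (quad (Fin z, Fin w) ^ m) j =
      (\<Sum>i\<le>j. of_nat (m choose i) * z ^ (m - i) * (of_nat (m choose (j - i)) * w ^ (j - i))) / (1 - z * w) ^ m" for j
    unfolding quad_Fin smult_power power_mult_distrib coeff_smult coeff_mult U V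
    by (simp add: field_simps)
  show "coeff (quad (Fin z, Fin w) ^ m) (m + n) =
      (\<Sum>k\<le>m - n. of_nat (m choose (k + n)) * of_nat (m choose k) * z ^ k * w ^ (k + n)) / (1 - z * w) ^ m"
  proof -
    have "(\<Sum>i\<le>m + n. of_nat (m choose i) * z ^ (m - i) * (of_nat (m choose (m + n - i)) * w ^ (m + n - i)))
       = (\<Sum>i\<in>{n..m}. of_nat (m choose i) * z ^ (m - i) * (of_nat (m choose (m + n - i)) * w ^ (m + n - i)))"
      using n by (intro sum.mono_neutral_right) (auto simp: binomial_eq_0 not_le)
    also have "\<dots> = (\<Sum>k\<le>m - n. of_nat (m choose (k + n)) * of_nat (m choose k) * z ^ k * w ^ (k + n))"
    proof (rule sum.reindex_bij_witness[of _ "\<lambda>k. m - k" "\<lambda>i. m - i"])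
      fix i assume "i \<in> {n..m}"
      then have "m choose (m - i) = m choose i" "m - i + n = m + n - i" "i \<le> m"
        by (simp_all add: binomial_symmetric[symmetric])
      then show "of_nat (m choose (m - i + n)) * of_nat (m choose (m - i)) * z ^ (m - i) * w ^ (m - i + n)
         = of_nat (m choose i) * z ^ (m - i) * (of_nat (m choose (m + n - i)) * w ^ (m + n - i))"
        by simp
    qed (use n in auto)
    finally show ?thesis by (simp add: c)
  qed
  show "coeff (quad (Fin z, Fin w) ^ m) (m - n) =
      (\<Sum>k\<le>m - n. of_nat (m choose (k + n)) * of_nat (m choose k) * z ^ (k + n) * w ^ k) / (1 - z * w) ^ m"
  proof -
    have "(\<Sum>i\<le>m - n. of_nat (m choose i) * z ^ (m - i) * (of_nat (m choose (m - n - i)) * w ^ (m - n - i)))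
       = (\<Sum>k\<le>m - n. of_nat (m choose (k + n)) * of_nat (m choose k) * z ^ (k + n) * w ^ k)"
    proof (rule sum.reindex_bij_witness[of _ "\<lambda>k. m - n - k" "\<lambda>i. m - n - i"])
      fix i assume "i \<in> {..m - n}"
      then have "m - n - i + n = m - i" "m choose (m - i) = m choose i"
        using n by (auto simp: binomial_symmetric[symmetric])
      then show "of_nat (m choose (m - n - i + n)) * of_nat (m choose (m - n - i)) * z ^ (m - n - i + n) * w ^ (m - n - i)
         = of_nat (m choose i) * z ^ (m - i) * (of_nat (m choose (m - n - i)) * w ^ (m - n - i))"
        by simp
    qed auto
    then show ?thesis by (simp add: c)
  qed
qed

lemma pochhammer_neg_of_nat:
  "pochhammer (- of_nat m) k = ((-1) ^ k * fact k * of_nat (m choose k) :: complex)"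
proof -
  have "(-1) ^ k * fact k * of_nat (m choose k) =
      ((-1) ^ k * (-1) ^ k) * (pochhammer (- of_nat m) k :: complex)"
    using gbinomial_pochhammer[of "of_nat m :: complex" k] by (simp add: binomial_gbinomial)
  then show ?thesis by (simp flip: power_mult_distrib)
qed

lemma binomial_times_hyp2F1:
  assumes "n \<le> m"
  shows "of_nat (m choose n) * hyp2F1 (- of_nat m) (of_nat n - of_nat m) (of_nat n + 1) t =
    (\<Sum>k\<le>m - n. of_nat (m choose (k + n)) * of_nat (m choose k) * t ^ k)"
proof -
  have b: "of_nat n - of_nat m = (- of_nat (m - n) :: complex)"
    using assms by (simp add: of_nat_diff)
  have poch: "pochhammer (of_nat n + 1) k = (fact (n + k) / fact n :: complex)" for k
    using pochhammer_product'[of "1 :: complex" n k]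
    by (simp add: pochhammer_fact[symmetric] add.commute field_simps)
  have choose: "of_nat (m choose n) * (of_nat (m - n choose k) * fact k * fact n) =
      (of_nat (m choose (k + n)) * fact (n + k) :: complex)" if "k \<le> m - n" for k
  proof -
    have "of_nat (m choose n) = (fact m / (fact n * fact (m - n)) :: complex)"
      "of_nat (m - n choose k) = (fact (m - n) / (fact k * fact (m - n - k)) :: complex)"
      "of_nat (m choose (k + n)) = (fact m / (fact (k + n) * fact (m - n - k)) :: complex)"
      using that assms binomial_fact[of "k + n" m, where 'a = complex]
      by (simp_all add: binomial_fact add.commute)
    then show ?thesis by (simp only:) (simp add: field_simps)
  qed
  have "hyp2F1 (- of_nat m) (of_nat n - of_nat m) (of_nat n + 1) t =
     (\<Sum>k\<le>m - n. pochhammer (- of_nat m) k * pochhammer (of_nat n - of_nat m) k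
        / pochhammer (of_nat n + 1) k * (t ^ k / fact k))"
    unfolding hyp2F1_def
    by (rule suminf_finite) (auto simp: b pochhammer_of_nat_eq_0_iff not_le)
  also have "of_nat (m choose n) * \<dots> = (\<Sum>k\<le>m - n. of_nat (m choose (k + n)) * of_nat (m choose k) * t ^ k)"
    unfolding sum_distrib_left
  proof (rule sum.cong)
    fix k assume "k \<in> {..m - n}"
    then have k: "k \<le> m - n" by simp
    have "of_nat (m choose n) * (pochhammer (- of_nat m) k * pochhammer (of_nat n - of_nat m) k
        / pochhammer (of_nat n + 1) k * (t ^ k / fact k))
      = ((-1) ^ k * (-1) ^ k) * (of_nat (m choose n) * (of_nat (m - n choose k) * fact k * fact n)) * of_nat (m choose k) * t ^ k / (fact (n + k) :: complex)"
      unfolding b pochhammer_neg_of_nat poch by (simp add: field_simps)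
    also have "\<dots> = of_nat (m choose (k + n)) * of_nat (m choose k) * t ^ k"
      unfolding choose[OF k] by (simp flip: power_mult_distrib)
    finally show "of_nat (m choose n) * (pochhammer (- of_nat m) k * pochhammer (of_nat n - of_nat m) k
        / pochhammer (of_nat n + 1) k * (t ^ k / fact k)) = of_nat (m choose (k + n)) * of_nat (m choose k) * t ^ k" .
  qed simp
  finally show ?thesis .
qed

lemma poisson_mode_formula_Fin:
  assumes zw: "z * w \<noteq> 1" and n: "\<bar>n\<bar> \<le> int m"
  shows "(-1) powi n * of_nat (m choose nat \<bar>n\<bar>) * (1 - z * w) powi (- int m)
     * hyp2F1 (- of_nat m) (of_int \<bar>n\<bar> - of_nat m) (of_int \<bar>n\<bar> + 1) (z * w)
     * (if n \<ge> 0 then w ^ nat n else z ^ nat \<bar>n\<bar>) =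
     (-1) ^ nat \<bar>n\<bar> * coeff (quad (Fin z, Fin w) ^ m) (nat (int m + n))"
proof -
  define k where "k = nat \<bar>n\<bar>"
  have k: "k \<le> m" "\<bar>n\<bar> = int k" using n by (auto simp: k_def)
  have sign: "(-1) powi n = ((-1) ^ k :: complex)"
    using k(2) by (auto simp: abs_if power_int_minus split: if_splits)
      (metis minus_minus power_int_minus_one_minus power_int_of_nat)
  have "(-1) powi n * of_nat (m choose nat \<bar>n\<bar>) * (1 - z * w) powi (- int m)
     * hyp2F1 (- of_nat m) (of_int \<bar>n\<bar> - of_nat m) (of_int \<bar>n\<bar> + 1) (z * w)
     * (if n \<ge> 0 then w ^ nat n else z ^ nat \<bar>n\<bar>) =
     (-1) ^ k * (of_nat (m choose k) * hyp2F1 (- of_nat m) (of_nat k - of_nat m) (of_nat k + 1) (z * w))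
       * (if n \<ge> 0 then w ^ k else z ^ k) / (1 - z * w) ^ m"
    unfolding sign k(2) using k(2) by (simp add: power_int_minus divide_inverse abs_if split: if_splits)
  also have "\<dots> = (-1) ^ k * ((\<Sum>i\<le>m - k. of_nat (m choose (i + k)) * of_nat (m choose i) * (z * w) ^ i
      * (if n \<ge> 0 then w ^ k else z ^ k)) / (1 - z * w) ^ m)"
    unfolding binomial_times_hyp2F1[OF k(1)] by (simp add: sum_distrib_right)
  also have "\<dots> = (-1) ^ k * coeff (quad (Fin z, Fin w) ^ m) (nat (int m + n))"
  proof (cases "n \<ge> 0")
    case True
    then have j: "nat (int m + n) = m + k" by (simp add: k_def nat_add_distrib)
    show ?thesis
      unfolding j coeff_quad_Fin_power(1)[OF zw k(1)]
      using True by (simp add: power_mult_distrib power_add algebra_simps)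
  next
    case False
    then have j: "nat (int m + n) = m - k" using k(2) by linarith
    show ?thesis
      unfolding j coeff_quad_Fin_power(2)[OF zw k(1)]
      using False by (simp add: power_mult_distrib power_add algebra_simps)
  qed
  finally show ?thesis by (simp add: k_def)
qed

text \<open>
  The coefficients of \<open>quad\<^sup>m\<close> are holomorphic on \<open>\<Omega>\<close>, so they provide the extension of the formula
  for the Poisson mode to infinite points.
\<close>

lemma poisson_mode_eq:
  assumes "\<bar>n\<bar> \<le> int m"
  shows "poisson_mode m n \<in> hol_\<Omega>"
    and "p \<in> \<Omega> \<Longrightarrow> poisson_mode m n p = (-1) ^ nat \<bar>n\<bar> * coeff (quad p ^ m) (nat (int m + n))"
proof -
  define f where "f z w = (-1) powi n * of_nat (m choose nat \<bar>n\<bar>) * (1 - z * w) powi (- int m)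
     * hyp2F1 (- of_nat m) (of_int \<bar>n\<bar> - of_nat m) (of_int \<bar>n\<bar> + 1) (z * w)
     * (if n \<ge> 0 then w ^ nat n else z ^ nat \<bar>n\<bar>)" for z w
  define G where "G p = (-1) ^ nat \<bar>n\<bar> * coeff (quad p ^ m) (nat (int m + n))" for p
  have mode: "poisson_mode m n = hol_ext f" by (simp add: poisson_mode_def f_def[abs_def])
  have G: "G \<in> hol_\<Omega>" unfolding G_def by (intro hol_\<Omega>_mult hol_\<Omega>_const coeff_quad_power_hol_\<Omega>)
  have Gf: "G (Fin z, Fin w) = f z w" if "(Fin z, Fin w) \<in> \<Omega>" for z w
    using poisson_mode_formula_Fin[OF _ assms, of z w] that by (simp add: G_def f_def Fin_in_\<Omega>_iff)
  let ?Q = "\<lambda>G. G \<in> hol_\<Omega> \<and> (\<forall>z w. (Fin z, Fin w) \<in> \<Omega> \<longrightarrow> G (Fin z, Fin w) = f z w)"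
  have "?Q (hol_ext f)" unfolding hol_ext_def by (rule someI[of ?Q G]) (use G Gf in blast)
  then show "poisson_mode m n \<in> hol_\<Omega>" by (simp add: mode)
  show "poisson_mode m n p = (-1) ^ nat \<bar>n\<bar> * coeff (quad p ^ m) (nat (int m + n))" if "p \<in> \<Omega>"
    using hol_ext_eq[OF G Gf that] by (simp add: mode G_def)
qed

lemma zonal_hol_\<Omega>: "(\<lambda>p. zonal m p q) \<in> hol_\<Omega>"
  unfolding zonal_def harmonic_mode_def
  by (intro hol_\<Omega>_sum hol_\<Omega>_mult hol_\<Omega>_const poisson_mode_eq(1)) auto

text \<open>
  The normalisation of the harmonic modes yields precisely the weights of the invariant pairing.
\<close>

lemma harmonic_mode_weight:
  assumes "k \<le> m"
  shows "inverse (of_nat (m choose k)) * ((- of_nat m - 1) gchoose k) =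
    ((-1) ^ k * fact (m + k) * fact (m - k) / (fact m)\<^sup>2 :: complex)"
proof -
  have "((- of_nat m - 1) gchoose k) = ((-1) ^ k * (of_nat (m + k) gchoose k) :: complex)"
  proof -
    have "- of_nat m - 1 = (- (of_nat m + 1) :: complex)"
      and "of_nat m + 1 + of_nat k - 1 = (of_nat (m + k) :: complex)" by simp_all
    then show ?thesis by (simp only: gbinomial_minus)
  qed
  also have "(of_nat (m + k) gchoose k) = (fact (m + k) / (fact k * fact m) :: complex)"
    using binomial_fact[of k "m + k", where 'a = complex] by (simp only: binomial_gbinomial[symmetric]) simp
  finally show ?thesis
    unfolding binomial_fact[OF assms, where 'a = complex]
    by (simp only:) (simp add: power2_eq_square field_simps)
qed

lemma zonal_eq_kernel:
  assumes p: "p \<in> \<Omega>" and q: "q \<in> \<Omega>"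
  shows "zonal m p q = of_nat (2 * m + 1) * zonal_kernel m p q"
proof -
  define c where "c r j = coeff (quad r ^ m) (nat (int m + j))" for r j
  have prod: "harmonic_mode m j p * harmonic_mode m (- j) q = of_nat (2 * m + 1) *
      ((-1) ^ nat \<bar>j\<bar> * fact (m + nat \<bar>j\<bar>) * fact (m - nat \<bar>j\<bar>) / (fact m)\<^sup>2 * c p j * c q (- j))"
    if "\<bar>j\<bar> \<le> int m" for j
  proof -
    define k where "k = nat \<bar>j\<bar>"
    have k: "k \<le> m" using that by (simp add: k_def)
    have sq: "complex_of_real (sqrt x) * of_real (sqrt x) = of_real x" if "x \<ge> 0" for x
      using that by (simp flip: of_real_mult)
    have s1: "complex_of_real (sqrt (2 * real m + 1)) * of_real (sqrt (2 * real m + 1)) = of_nat (2 * m + 1)"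
      by (subst sq) simp_all
    have s2: "inverse (complex_of_real (sqrt (real (m choose k)))) * inverse (of_real (sqrt (real (m choose k)))) =
        inverse (of_nat (m choose k))"
      unfolding inverse_mult_distrib[symmetric] by (subst sq) simp_all
    have s3: "csqrt g * csqrt g = g" for g by (metis power2_csqrt power2_eq_square)
    have m1: "(-1 :: complex) ^ k * (-1) ^ k = 1" by (simp flip: power_mult_distrib)
    have rearrange: "(x * y * r * (e * u)) * (x * y * r * (e * v)) = (x * x) * ((y * y) * (r * r)) * (e * e) * u * v"
      for x y r e u v :: complex by (simp add: algebra_simps)
    have P: "poisson_mode m j p = (-1) ^ k * c p j" "poisson_mode m (- j) q = (-1) ^ k * c q (- j)"
      using poisson_mode_eq(2)[of j m p] poisson_mode_eq(2)[of "- j" m q] that p q by (simp_all add: k_def c_def)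
    show ?thesis
      unfolding harmonic_mode_def abs_minus_cancel k_def[symmetric] P rearrange s1 s2 s3 m1
        harmonic_mode_weight[OF k] by simp
  qed
  have "zonal m p q = (\<Sum>j = - int m..int m. of_nat (2 * m + 1) *
      ((-1) ^ nat \<bar>j\<bar> * fact (m + nat \<bar>j\<bar>) * fact (m - nat \<bar>j\<bar>) / (fact m)\<^sup>2 * c p j * c q (- j)))"
    unfolding zonal_def by (intro sum.cong prod) auto
  also have "\<dots> = (\<Sum>k\<le>2 * m. of_nat (2 * m + 1) * ((-1) ^ (m + k) * fact k * fact (2 * m - k) / (fact m)\<^sup>2
     * coeff (quad p ^ m) k * coeff (quad q ^ m) (2 * m - k)))"
  proof (rule sum.reindex_bij_witness[of _ "\<lambda>k. int k - int m" "\<lambda>j. nat (int m + j)"])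
    fix j assume j: "j \<in> {- int m..int m}"
    define k where "k = nat (int m + j)"
    have k: "k \<le> 2 * m" and j_eq: "j = int k - int m" and mj: "nat (int m + - j) = 2 * m - k"
      using j by (auto simp: k_def)
    have "(-1 :: complex) ^ (m + k) * fact k * fact (2 * m - k) =
       (-1) ^ nat \<bar>j\<bar> * fact (m + nat \<bar>j\<bar>) * fact (m - nat \<bar>j\<bar>)"
    proof (cases "k \<ge> m")
      case True
      then have "nat \<bar>j\<bar> = k - m" by (simp add: j_eq nat_diff_distrib)
      then show ?thesis using True k by (simp add: minus_one_power_iff mult_2)
    next
      case False
      then have "nat \<bar>j\<bar> = m - k" by (simp add: j_eq)
      then show ?thesis using False k by (simp add: minus_one_power_iff mult_2)
    qed
    then show "of_nat (2 * m + 1) * ((-1) ^ (m + nat (int m + j)) * fact (nat (int m + j))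
       * fact (2 * m - nat (int m + j)) / (fact m)\<^sup>2
       * coeff (quad p ^ m) (nat (int m + j)) * coeff (quad q ^ m) (2 * m - nat (int m + j))) =
       of_nat (2 * m + 1) *
      ((-1) ^ nat \<bar>j\<bar> * fact (m + nat \<bar>j\<bar>) * fact (m - nat \<bar>j\<bar>) / (fact m)\<^sup>2 * c p j * c q (- j))"
      unfolding c_def mj unfolding k_def[symmetric] by simp
  qed auto
  also have "\<dots> = of_nat (2 * m + 1) * zonal_kernel m p q"
    by (simp only: zonal_kernel_def pairing_def sum_distrib_left)
  finally show ?thesis .
qed

section \<open>Functions of the invariant of degree one\<close>

abbreviation origin :: "sphere \<times> sphere" where "origin \<equiv> (Fin 0, Fin 0)"

text \<open>
  Polarised discriminant of the two quadratic forms: a holomorphic and Moebius invariant substitute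
  for \<open>z w\<close> that takes finite values on all of \<open>\<Omega>\<close>; with \<open>q\<close> the origin it is
  \<open>(1 + z w) / (1 - z w)\<close>.
\<close>

definition xi :: "sphere \<times> sphere \<Rightarrow> sphere \<times> sphere \<Rightarrow> complex" where
  "xi = zonal_kernel 1"

lemma xi_hol_\<Omega>: "(\<lambda>p. xi p q) \<in> hol_\<Omega>"
  unfolding xi_def by (rule zonal_kernel_hol_\<Omega>)

lemma quad_origin: "quad origin = [:0, 1:]"
  by (simp add: quad_Fin)

lemma origin_in_\<Omega>: "origin \<in> \<Omega>"
  by (simp add: Fin_in_\<Omega>_iff)

lemma pairing_1: "pairing 1 f g =
    coeff f 1 * coeff g 1 - 2 * coeff f 0 * coeff g 2 - 2 * coeff f 2 * coeff g 0"
  by (simp add: pairing_def eval_nat_numeral)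

lemma zonal_kernel_origin: "zonal_kernel m origin origin = 1"
proof -
  have q: "quad origin ^ m = monom 1 m"
    by (simp add: quad_origin monom_altdef)
  have "zonal_kernel m origin origin = (\<Sum>k\<le>2 * m. if k = m then 1 else 0)"
    unfolding zonal_kernel_def pairing_def q
    by (intro sum.cong) (auto simp: power2_eq_square simp flip: power_add mult_2)
  also have "\<dots> = 1" by simp
  finally show ?thesis .
qed

text \<open>
  By transitivity and invariance, only the origin has to be considered.
\<close>

lemma zonal_kernel_diag:
  assumes "q \<in> \<Omega>"
  shows "zonal_kernel m q q = 1"
proof -
  obtain \<psi> where "\<psi> \<in> moebius_transformations" "moebius_lift \<psi> origin = q"
    using moebius_lift_transitive[OF assms] .
  then show ?thesis
    using zonal_kernel_moebius[of \<psi> origin origin m] zonal_kernel_origin origin_in_\<Omega> by auto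
qed

lemma quad_discriminant:
  assumes "q \<in> \<Omega>"
  shows "(coeff (quad q) 1)\<^sup>2 - 4 * coeff (quad q) 0 * coeff (quad q) 2 = 1"
proof -
  show ?thesis
    using zonal_kernel_diag[OF assms, of 1]
    unfolding zonal_kernel_def pairing_1 power_one_right by (simp add: power2_eq_square mult.assoc)
qed

lemma xi_Fin:
  "xi (Fin z, Fin w) q = ((1 + z * w) * coeff (quad q) 1 - 2 * z * coeff (quad q) 2
     - 2 * w * coeff (quad q) 0) / (1 - z * w)"
  unfolding xi_def zonal_kernel_def pairing_1 power_one_right
  by (simp add: quad_Fin eval_nat_numeral inverse_eq_divide diff_divide_distrib add_divide_distrib algebra_simps)

text \<open>
  On functions of \<open>X = xi (\<cdot>, q)\<close> the Laplacian is four times the Legendre operator, because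
  \<open>(1 - z w)\<^sup>2 X\<^sub>z X\<^sub>w = X\<^sup>2 - 1\<close> and \<open>(1 - z w)\<^sup>2 X\<^sub>z\<^sub>w = 2 X\<close>.  The first identity is where the
  discriminant of \<open>quad q\<close> being \<open>1\<close> enters.  As \<open>X\<close> is holomorphic on all of \<open>\<Omega>\<close>, the right-hand
  side is the holomorphic extension that the Laplacian asks for.
\<close>

lemma laplacian_xi:
  assumes q: "q \<in> \<Omega>" and h: "h holomorphic_on UNIV" and p: "p \<in> \<Omega>"
    and F: "\<And>p. p \<in> \<Omega> \<Longrightarrow> F p = h (xi p q)"
  shows "laplacian F p = 4 * (((xi p q)\<^sup>2 - 1) * deriv (deriv h) (xi p q) + 2 * xi p q * deriv h (xi p q))"
proof -
  define \<alpha> \<beta> \<gamma> where "\<alpha> = coeff (quad q) 0" and "\<beta> = coeff (quad q) 1" and "\<gamma> = coeff (quad q) 2"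
  have disc: "\<beta>\<^sup>2 - 4 * \<alpha> * \<gamma> = 1" using quad_discriminant[OF q] by (simp add: \<alpha>_def \<beta>_def \<gamma>_def)
  define X where "X z w = ((1 + z * w) * \<beta> - 2 * z * \<gamma> - 2 * w * \<alpha>) / (1 - z * w)" for z w
  have X: "xi (Fin z, Fin w) q = X z w" for z w
    by (simp add: xi_Fin X_def \<alpha>_def \<beta>_def \<gamma>_def)
  define A where "A z = - 2 * (\<alpha> - \<beta> * z + \<gamma> * z\<^sup>2)" for z
  define B where "B w = - 2 * (\<gamma> - \<beta> * w + \<alpha> * w\<^sup>2)" for w
  have Xw: "(X z has_field_derivative A z / (1 - z * w)\<^sup>2) (at w)" if "z * w \<noteq> 1" for z w
    unfolding X_def A_def using that
    by (auto intro!: derivative_eq_intros simp: divide_simps power2_eq_square) (simp add: algebra_simps)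
  have Xz: "((\<lambda>z. X z w) has_field_derivative B w / (1 - z * w)\<^sup>2) (at z)" if "z * w \<noteq> 1" for z w
    unfolding X_def B_def using that
    by (auto intro!: derivative_eq_intros simp: divide_simps power2_eq_square) (simp add: algebra_simps)
  have Azw: "((\<lambda>z. A z / (1 - z * w)\<^sup>2) has_field_derivative 2 * X z w / (1 - z * w)\<^sup>2) (at z)"
    if "z * w \<noteq> 1" for z w
    unfolding X_def A_def using that
    by (auto intro!: derivative_eq_intros simp: divide_simps power2_eq_square) (simp add: algebra_simps)
  have AB: "A z * B w = (1 - z * w)\<^sup>2 * ((X z w)\<^sup>2 - 1)" if "z * w \<noteq> 1" for z w
  proof -
    have "(1 - z * w)\<^sup>2 * ((X z w)\<^sup>2 - 1) =
        ((1 + z * w) * \<beta> - 2 * z * \<gamma> - 2 * w * \<alpha>)\<^sup>2 - (1 - z * w)\<^sup>2 * (\<beta>\<^sup>2 - 4 * \<alpha> * \<gamma>)"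
      using that by (simp add: disc X_def power_divide right_diff_distrib)
    also have "\<dots> = A z * B w"
      by (simp add: A_def B_def power2_eq_square algebra_simps)
    finally show ?thesis by simp
  qed
  have h1: "(h has_field_derivative deriv h x) (at x)" for x
    using holomorphic_derivI[OF h open_UNIV UNIV_I] .
  have h': "deriv h holomorphic_on UNIV" using h by (rule holomorphic_deriv) simp
  have h2: "(deriv h has_field_derivative deriv (deriv h) x) (at x)" for x
    using holomorphic_derivI[OF h' open_UNIV UNIV_I] .
  have h'': "deriv (deriv h) holomorphic_on UNIV" using h' by (rule holomorphic_deriv) simp
  define L where "L x = 4 * ((x\<^sup>2 - 1) * deriv (deriv h) x + 2 * x * deriv h x)" for x
  have L: "L holomorphic_on UNIV"
    unfolding L_def by (intro holomorphic_intros h' h'')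
  have "laplacian F p = L (xi p q)"
  proof (rule laplacian_eqI[where f = "\<lambda>z w. h (X z w)"
        and g = "\<lambda>z w. deriv h (X z w) * (A z / (1 - z * w)\<^sup>2)"
        and k = "\<lambda>z w. deriv (deriv h) (X z w) * (B w / (1 - z * w)\<^sup>2) * (A z / (1 - z * w)\<^sup>2)
           + (2 * X z w / (1 - z * w)\<^sup>2) * deriv h (X z w)"])
    show "(\<lambda>p. L (xi p q)) \<in> hol_\<Omega>"
      by (rule hol_\<Omega>_compose_entire[OF xi_hol_\<Omega> L])
  next
    fix z w :: complex assume zw: "z * w \<noteq> 1"
    show "F (Fin z, Fin w) = h (X z w)" using F zw by (simp add: Fin_in_\<Omega>_iff X)
    show "((\<lambda>w. h (X z w)) has_field_derivative deriv h (X z w) * (A z / (1 - z * w)\<^sup>2)) (at w)"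
      by (rule DERIV_chain2[OF h1 Xw[OF zw]])
    show "((\<lambda>z. deriv h (X z w) * (A z / (1 - z * w)\<^sup>2)) has_field_derivative
       deriv (deriv h) (X z w) * (B w / (1 - z * w)\<^sup>2) * (A z / (1 - z * w)\<^sup>2)
           + (2 * X z w / (1 - z * w)\<^sup>2) * deriv h (X z w)) (at z)"
      by (rule DERIV_mult[OF DERIV_chain2[OF h2 Xz[OF zw]] Azw[OF zw]])
    define r where "r = (1 - z * w)\<^sup>2"
    have r: "r \<noteq> 0" using zw by (simp add: r_def)
    have "4 * r * (deriv (deriv h) (X z w) * (B w / r) * (A z / r) + (2 * X z w / r) * deriv h (X z w))
      = 4 * (A z * B w / r * deriv (deriv h) (X z w) + 2 * X z w * deriv h (X z w))"
      using r by (simp add: field_simps)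
    also have "A z * B w / r = (X z w)\<^sup>2 - 1"
      unfolding AB[OF zw] using r by (simp add: r_def)
    finally show "4 * (1 - z * w)\<^sup>2 * (deriv (deriv h) (X z w) * (B w / (1 - z * w)\<^sup>2) * (A z / (1 - z * w)\<^sup>2)
           + (2 * X z w / (1 - z * w)\<^sup>2) * deriv h (X z w)) = L (xi (Fin z, Fin w) q)"
      by (simp add: r_def X L_def)
  qed (rule p)
  then show ?thesis by (simp add: L_def)
qed

text \<open>
  The leading coefficient \<open>x\<^sup>2 - 1\<close> vanishes at \<open>1\<close>, so the equation differentiated \<open>n\<close> times and
  evaluated there expresses the derivative of order \<open>n + 1\<close> by the one of order \<open>n\<close>.  Hence all
  derivatives of \<open>u\<close> at \<open>1\<close> vanish.
\<close>

lemma legendre_unique: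
  assumes u: "u holomorphic_on UNIV"
    and ode: "\<And>x. (x\<^sup>2 - 1) * deriv (deriv u) x + 2 * x * deriv u x = l * u x"
    and u1: "u 1 = 0"
  shows "u x = 0"
proof -
  define D where "D n = (deriv ^^ n) u" for n
  have D: "(D n has_field_derivative D (Suc n) x) (at x)" for n x
    unfolding D_def by (simp, rule holomorphic_derivI[OF holomorphic_higher_deriv[OF u open_UNIV] open_UNIV UNIV_I])
  have rec: "(x\<^sup>2 - 1) * D (n + 2) x + 2 * of_nat (n + 1) * x * D (n + 1) x
      + (of_nat (n * (n + 1)) - l) * D n x = 0" for n x
  proof (induction n arbitrary: x)
    case 0
    show ?case using ode[of x] by (simp add: D_def eval_nat_numeral algebra_simps)
  next
    case (Suc n)
    let ?E = "\<lambda>x. (x\<^sup>2 - 1) * D (n + 2) x + 2 * of_nat (n + 1) * x * D (n + 1) x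
      + (of_nat (n * (n + 1)) - l) * D n x"
    have "?E = (\<lambda>x. 0)" using Suc.IH by auto
    then have "(?E has_field_derivative 0) (at x)" by simp
    moreover have "(?E has_field_derivative
        (x\<^sup>2 - 1) * D (Suc n + 2) x + 2 * of_nat (Suc n + 1) * x * D (Suc n + 1) x
      + (of_nat (Suc n * (Suc n + 1)) - l) * D (Suc n) x) (at x)"
      by (auto intro!: derivative_eq_intros D simp: algebra_simps)
    ultimately show ?case using DERIV_unique by blast
  qed
  have D1: "D n 1 = 0" for n
  proof (induction n)
    case 0
    show ?case by (simp add: D_def u1)
  next
    case (Suc n)
    have "2 * of_nat (n + 1) * D (n + 1) 1 = 0" using rec[of 1 n] Suc by simp
    then show ?case by (simp del: of_nat_Suc)
  qed
  have zero: "(deriv ^^ n) (\<lambda>_. 0) (1 :: complex) = (0 :: complex)" for n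
    by (induction n) (simp_all add: fun_eq_iff)
  have "u x = (\<lambda>_. 0) x"
  proof (rule holomorphic_fun_eq_on_ball[of u 1 "dist 1 x + 1"])
    show "u holomorphic_on ball 1 (dist 1 x + 1)" using u by (rule holomorphic_on_subset) simp
    show "(deriv ^^ n) u 1 = (deriv ^^ n) (\<lambda>_. 0) 1" for n
      using D1[of n] by (simp add: D_def zero)
  qed auto
  then show ?thesis by simp
qed

text \<open>
  Move \<open>q\<close> to the origin.  The scalings \<open>(z, w) \<mapsto> (a z, w / a)\<close> fix the origin, and the one with
  \<open>a = w\<close> sends \<open>(z, w)\<close> to \<open>(z w, 1)\<close>.  So the function is determined by its values at the points
  \<open>(t, 1)\<close>; with \<open>t = (x - 1) / (x + 1)\<close> these points are parametrised by \<open>x = xi\<close>, which runs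
  through all of \<open>\<complex>\<close>, with \<open>t = \<infinity>\<close> at \<open>x = -1\<close>.
\<close>

lemma invariant_factors_through_xi:
  assumes F: "F \<in> hol_\<Omega>" and inv: "stabilizer_invariant q F" and q: "q \<in> \<Omega>"
  shows "\<exists>h. h holomorphic_on UNIV \<and> (\<forall>p\<in>\<Omega>. F p = h (xi p q))"
proof -
  obtain \<psi> where \<psi>: "\<psi> \<in> moebius_transformations" and \<psi>q: "moebius_lift \<psi> origin = q"
    using moebius_lift_transitive[OF q] .
  obtain \<psi>' where \<psi>': "\<psi>' \<in> moebius_transformations" "\<psi> \<circ> \<psi>' = id" "\<psi>' \<circ> \<psi> = id"
    using moebius_transformations_inverse[OF \<psi>] .
  define G where "G p = F (moebius_lift \<psi> p)" for p
  have G: "G \<in> hol_\<Omega>" unfolding G_def by (rule hol_\<Omega>_moebius_lift[OF F \<psi>])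
  have scale: "G (moebius_lift (moebius a 0 0 1) p) = G p" if "a \<noteq> 0" "p \<in> \<Omega>" for a p
  proof -
    have a: "moebius a 0 0 1 \<in> moebius_transformations"
      using that unfolding moebius_transformations_def by fastforce
    let ?S = "moebius_lift (\<psi> \<circ> moebius a 0 0 1 \<circ> \<psi>')"
    have S: "?S \<in> moebius_group_\<Omega>"
      unfolding moebius_group_\<Omega>_eq using moebius_transformations_comp \<psi> \<psi>'(1) a by blast
    have "moebius_lift (moebius a 0 0 1) origin = origin"
      using that by (simp add: moebius_lift_def)
    then have "?S q = q"
      using \<psi>'(3) by (simp add: \<psi>q flip: \<psi>q moebius_lift_comp)
         (metis \<psi>'(3) \<psi>q moebius_lift_comp moebius_lift_id)
    then have "F (?S (moebius_lift \<psi> p)) = F (moebius_lift \<psi> p)"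
      using inv S moebius_lift_in_\<Omega>[OF that(2) \<psi>] by (auto simp: stabilizer_invariant_def)
    moreover have "?S (moebius_lift \<psi> p) = moebius_lift \<psi> (moebius_lift (moebius a 0 0 1) p)"
      by (metis \<psi>'(3) moebius_lift_comp moebius_lift_id)
    ultimately show ?thesis by (simp add: G_def)
  qed
  define h where "h x = G (pt (x - 1) (x + 1), pt 1 1)" for x
  have h_diff: "h field_differentiable at x" for x
  proof -
    have ne: "x - 1 \<noteq> 0 \<or> x + 1 \<noteq> 0" for x :: complex
      by (cases "x = 1") auto
    have d: "cdiff2 (\<lambda>y. fst y + (-1)) (x, 0)" "cdiff2 (\<lambda>y. fst y + 1) (x, 0)"
      by (intro cdiff2_add cdiff2_fst cdiff2_const)+
    have "(pt (x - 1) (x + 1), pt 1 1) \<in> \<Omega>" using ne[of x] by (simp add: \<Omega>_pt_iff)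
    then have "cdiff2 (\<lambda>y. G (pt (fst y + (-1)) (fst y + 1), pt 1 1)) (x, 0)"
      using ne[of x] by (intro hol_\<Omega>_compose_pt[OF G d cdiff2_const cdiff2_const]) auto
    then obtain H' a b where H: "((\<lambda>y. G (pt (fst y + (-1)) (fst y + 1), pt 1 1)) has_derivative H') (at (x, 0))"
      "\<And>h k. H' (h, k) = a * h + b * k"
      by (rule cdiff2E) blast
    have "((\<lambda>s. (s, 0 :: complex)) has_derivative (\<lambda>s. (s, 0))) (at x)"
      by (auto intro!: derivative_eq_intros)
    from has_derivative_compose[OF this H(1)]
    have "(h has_field_derivative a) (at x)"
      unfolding has_field_derivative_def by (simp add: h_def[abs_def] H(2))
    then show ?thesis by (auto simp: field_differentiable_def)
  qed
  then have h: "h holomorphic_on UNIV"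
    by (simp add: holomorphic_on_def field_differentiable_at_within)
  have xi0: "xi (Fin z, Fin w) origin = (1 + z * w) / (1 - z * w)" for z w
    by (simp add: xi_Fin quad_origin eval_nat_numeral)
  have ne0: "G (Fin z, Fin w) = h (xi (Fin z, Fin w) origin)" if zw: "z * w \<noteq> 1" and w: "w \<noteq> 0" for z w
  proof -
    define x where "x = (1 + z * w) / (1 - z * w)"
    have "x - 1 = (2 / (1 - z * w)) * (z * w)" "x + 1 = 2 / (1 - z * w)"
      using zw by (simp_all add: x_def field_simps)
    then have "pt (x - 1) (x + 1) = Fin (z * w)"
      using zw by (simp add: pt_def)
    moreover have "moebius_lift (moebius w 0 0 1) (Fin z, Fin w) = (Fin (z * w), Fin 1)"
      using w by (simp add: moebius_lift_def)
    ultimately show ?thesis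
      using scale[OF w, of "(Fin z, Fin w)"] zw
      by (simp add: xi0 h_def x_def Fin_in_\<Omega>_iff pt_def)
  qed
  have hxi: "(\<lambda>p. h (xi p origin)) \<in> hol_\<Omega>"
    by (rule hol_\<Omega>_compose_entire[OF xi_hol_\<Omega> h])
  have G_eq: "G p = h (xi p origin)" if "p \<in> \<Omega>" for p
  proof (rule hol_\<Omega>_eqI[OF G hxi _ that])
    fix z w assume zw: "(Fin z, Fin w) \<in> \<Omega>"
    show "G (Fin z, Fin w) = h (xi (Fin z, Fin w) origin)"
    proof (cases "w = 0")
      case False
      then show ?thesis using ne0 zw by (simp add: Fin_in_\<Omega>_iff)
    next
      case True
      \<comment> \<open>No scaling moves \<open>(z, 0)\<close> to a point \<open>(t, 1)\<close>, so this case follows by continuity.\<close>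
      have lim: "((\<lambda>t. H (Fin z, Fin t)) \<longlongrightarrow> H (Fin z, Fin 0)) (at 0)" if "H \<in> hol_\<Omega>" for H
      proof -
        have "cdiff2 (\<lambda>y. H (pt (fst y) 1, pt (snd y) 1)) (z, 0)"
          by (rule hol_\<Omega>_compose_pt[OF that cdiff2_fst cdiff2_const cdiff2_snd cdiff2_const]) (auto simp: \<Omega>_pt_iff)
        then have "isCont (\<lambda>y. H (Fin (fst y), Fin (snd y))) (z, 0)"
          by (simp add: cdiff2_isCont flip: Fin_eq_pt)
        from isCont_tendsto_compose[OF this tendsto_Pair[OF tendsto_const tendsto_ident_at]]
        show ?thesis by simp
      qed
      have "((\<lambda>t. z * t) \<longlongrightarrow> z * 0) (at 0)" by (intro tendsto_intros)
      then have "\<forall>\<^sub>F t in at 0. z * t \<noteq> 1" by (rule tendsto_imp_eventually_ne) simp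
      moreover have "\<forall>\<^sub>F t in at (0 :: complex). t \<noteq> 0" by (simp add: eventually_at_filter)
      ultimately have "\<forall>\<^sub>F t in at 0. G (Fin z, Fin t) = h (xi (Fin z, Fin t) origin)"
        by eventually_elim (rule ne0)
      from tendsto_cong[THEN iffD1, OF this lim[OF G]] lim[OF hxi] True show ?thesis
        using tendsto_unique[OF trivial_limit_at] by blast
    qed
  qed
  have "F p = h (xi p q)" if p: "p \<in> \<Omega>" for p
  proof -
    have p': "moebius_lift \<psi>' p \<in> \<Omega>" using moebius_lift_in_\<Omega>[OF p \<psi>'(1)] .
    have round_trip: "moebius_lift \<psi> (moebius_lift \<psi>' p) = p" by (simp add: moebius_lift_comp \<psi>'(2))
    have "F p = G (moebius_lift \<psi>' p)" by (simp add: G_def round_trip)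
    also have "\<dots> = h (xi (moebius_lift \<psi>' p) origin)" by (rule G_eq[OF p'])
    also have "xi (moebius_lift \<psi>' p) origin = xi p q"
      using zonal_kernel_moebius[OF \<psi> p' origin_in_\<Omega>, of 1] by (simp only: xi_def round_trip \<psi>q)
    finally show ?thesis .
  qed
  with h show ?thesis by blast
qed

section \<open>Invariance and reduction to the origin\<close>

lemma moebius_group_\<Omega>_image:
  assumes "S \<in> moebius_group_\<Omega>" "p \<in> \<Omega>"
  shows "S p \<in> \<Omega>"
  using assms unfolding moebius_group_\<Omega>_eq
  by (auto simp: moebius_lift_in_\<Omega> swap_in_\<Omega> simp del: swap_simp)

lemma zonal_invariant:
  assumes "S \<in> moebius_group_\<Omega>" "p \<in> \<Omega>" "q \<in> \<Omega>"
  shows "zonal m (S p) (S q) = zonal m p q"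
  using assms by (simp add: zonal_eq_kernel moebius_group_\<Omega>_image zonal_kernel_invariant)

text \<open>
  The matrix with rows \<open>(-1, u)\<close> and \<open>(-v, 1)\<close> acts on \<open>1 / w\<close> so that \<open>w\<close> becomes
  \<open>(v - w) / (1 - u w)\<close>; numerator and denominator both come out with the opposite sign.
\<close>

lemma T_map_in_moebius_group:
  assumes "(Fin u, Fin v) \<in> \<Omega>"
  shows "T_map u v \<in> moebius_group_\<Omega>" "T_map u v (Fin u, Fin v) = origin"
proof -
  have uv: "(-1) * 1 - u * (- v) \<noteq> 0" using assms by (simp add: Fin_in_\<Omega>_iff algebra_simps)
  have uv': "(-1) * 1 - v * (- u) \<noteq> 0" using uv by (simp add: mult.commute)
  have "T_map u v = moebius_lift (moebius (-1) u (- v) 1)"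
  proof
    fix p :: "sphere \<times> sphere"
    obtain z w where p: "p = (z, w)" by (cases p)
    obtain n d where w: "n \<noteq> 0 \<or> d \<noteq> 0" "w = pt n d" using ex_pt by blast
    have scale: "pt (- a) (- b) = pt a b" for a b by (simp add: pt_def)
    have "sphere_inverse (moebius (-1) u (- v) 1 (sphere_inverse w)) = pt (n - v * d) (u * n - d)"
      using w moebius_pt[of d n "-1" 1 u "- v"] uv by (auto simp: pt_inverse)
    also have "\<dots> = pt (v * d - n) (d - u * n)"
      using scale[of "v * d - n" "d - u * n"] by simp
    also have "\<dots> = moebius (-1) v (- u) 1 w"
      using w moebius_pt[of n d "-1" 1 v "- u"] uv' by (simp add: algebra_simps)
    finally show "T_map u v p = moebius_lift (moebius (-1) u (- v) 1) p"
      by (simp add: p T_map_def moebius_lift_def)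
  qed
  moreover have "moebius (-1) u (- v) 1 \<in> moebius_transformations"
    using uv unfolding moebius_transformations_def by blast
  ultimately show "T_map u v \<in> moebius_group_\<Omega>" by (simp add: moebius_group_\<Omega>_eq)
  show "T_map u v (Fin u, Fin v) = origin"
    using assms by (auto simp: T_map_def Fin_in_\<Omega>_iff algebra_simps)
qed

lemma zonal_T_map:
  assumes "(Fin u, Fin v) \<in> \<Omega>" "p \<in> \<Omega>"
  shows "zonal m p (Fin u, Fin v) = zonal m (T_map u v p) origin"
  using zonal_invariant[OF T_map_in_moebius_group(1)[OF assms(1)] assms(2,1)]
  by (simp add: T_map_in_moebius_group(2)[OF assms(1)])

text \<open>
  The map \<open>(z, w) \<mapsto> (1 / w, 1 / z)\<close> belongs to the group and sends \<open>(u, v)\<close> to a finite point, to which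
  \<open>zonal_T_map\<close> applies.
\<close>

lemma zonal_T_tilde:
  assumes uv: "(u, v) \<in> \<Omega>" and ne: "u \<noteq> Fin 0" "v \<noteq> Fin 0" and p: "p \<in> \<Omega>"
  shows "zonal m p (u, v) = zonal m (T_tilde u v p) origin"
proof -
  let ?I = "\<lambda>(z, w). (sphere_inverse w, sphere_inverse z)"
  have inv: "moebius 0 1 1 0 x = sphere_inverse x" for x by (cases x) (auto simp: inverse_eq_divide)
  have I_eq: "?I = moebius_lift (moebius 0 1 1 0) \<circ> prod.swap"
    by (auto simp: moebius_lift_def fun_eq_iff inv)
  have "moebius 0 1 1 0 \<in> moebius_transformations"
    unfolding moebius_transformations_def by fastforce
  then have I: "?I \<in> moebius_group_\<Omega>" unfolding I_eq moebius_group_\<Omega>_eq by blast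
  have fin: "sphere_inverse x = Fin (the_Fin (sphere_inverse x))" if "x \<noteq> Fin 0" for x
    using that by (cases x) auto
  have Iuv: "?I (u, v) = (Fin (the_Fin (sphere_inverse v)), Fin (the_Fin (sphere_inverse u)))"
    using fin ne by simp
  have "zonal m p (u, v) = zonal m (?I p) (?I (u, v))"
    using zonal_invariant[OF I p uv] by (rule sym)
  also have "\<dots> = zonal m (T_tilde u v p) origin"
    using zonal_T_map[of "the_Fin (sphere_inverse v)" "the_Fin (sphere_inverse u)" "?I p" m]
      moebius_group_\<Omega>_image[OF I uv] moebius_group_\<Omega>_image[OF I p]
    unfolding Iuv by (cases p) (simp add: T_tilde_def)
  finally show ?thesis .
qed

lemma zonal_eigenfunction:
  assumes q: "q \<in> \<Omega>"
  shows "(\<lambda>p. zonal m p q) \<in> eigenspace_\<Omega> (4 * of_nat m * (of_nat m + 1))"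
proof -
  have "laplacian (\<lambda>p. zonal m p q) p = 4 * of_nat m * (of_nat m + 1) * (of_nat (2 * m + 1) * zonal_kernel m p q)"
    if "p \<in> \<Omega>" for p
    using that by (rule zonal_kernel_laplacian) (simp add: zonal_eq_kernel q Fin_in_\<Omega>_iff)
  then show ?thesis
    by (simp add: eigenspace_\<Omega>_def zonal_hol_\<Omega> zonal_eq_kernel q)
qed

lemma zonal_stabilizer_invariant:
  assumes "q \<in> \<Omega>"
  shows "stabilizer_invariant q (\<lambda>p. zonal m p q)"
  unfolding stabilizer_invariant_def using zonal_invariant[OF _ _ assms] by metis

section \<open>Uniqueness of invariant eigenfunctions\<close>

text \<open>
  At the origin the points \<open>((x - 1) / (x + 1), 1)\<close> attain all values.
\<close>

lemma xi_surj:
  assumes q: "q \<in> \<Omega>"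
  obtains p where "p \<in> \<Omega>" "xi p q = x"
proof -
  obtain \<psi> where \<psi>: "\<psi> \<in> moebius_transformations" "moebius_lift \<psi> origin = q"
    using moebius_lift_transitive[OF q] .
  define p where "p = (pt (x - 1) (x + 1), pt 1 1)"
  have ne: "x - 1 \<noteq> 0 \<or> x + 1 \<noteq> 0"
    by (cases "x = 1") auto
  have p: "p \<in> \<Omega>" using ne by (simp add: p_def \<Omega>_pt_iff)
  have "xi p origin = x"
    unfolding xi_def zonal_kernel_def pairing_1 power_one_right
    using ne by (simp add: p_def quad_pt quad_origin eval_nat_numeral field_simps)
  then have "xi (moebius_lift \<psi> p) q = x"
    using zonal_kernel_moebius[OF \<psi>(1) p origin_in_\<Omega>, of 1] by (simp only: xi_def \<psi>(2))
  with moebius_lift_in_\<Omega>[OF p \<psi>(1)] show ?thesis by (rule that)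
qed

text \<open>
  Since \<open>xi\<close> is onto \<open>\<complex>\<close>, the eigenvalue equation on \<open>\<Omega>\<close> gives the Legendre equation at every \<open>x\<close>.
\<close>

lemma eigenfunction_legendre:
  assumes q: "q \<in> \<Omega>" and F: "F \<in> eigenspace_\<Omega> l"
    and h: "h holomorphic_on UNIV" and eq: "\<And>p. p \<in> \<Omega> \<Longrightarrow> F p = h (xi p q)"
  shows "(x\<^sup>2 - 1) * deriv (deriv h) x + 2 * x * deriv h x = l / 4 * h x"
proof -
  obtain p where p: "p \<in> \<Omega>" "xi p q = x" using xi_surj[OF q] .
  have "4 * ((x\<^sup>2 - 1) * deriv (deriv h) x + 2 * x * deriv h x) = l * h x"
    using laplacian_xi[OF q h p(1) eq] F p eq[OF p(1)] by (simp add: eigenspace_\<Omega>_def)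
  then show ?thesis by (simp add: field_simps)
qed

text \<open>
  Both functions are entire functions of \<open>xi\<close> that solve the same Legendre equation.  The point \<open>q\<close>
  lies over \<open>xi = 1\<close>, where the difference \<open>F - (F q / G q) G\<close> vanishes.
\<close>

lemma invariant_eigenfunction_unique:
  assumes q: "q \<in> \<Omega>" and F: "F \<in> eigenspace_\<Omega> l" "stabilizer_invariant q F"
    and G: "G \<in> eigenspace_\<Omega> l" "stabilizer_invariant q G" "G q \<noteq> 0" and p: "p \<in> \<Omega>"
  shows "F p = F q / G q * G p"
proof -
  have hol: "F \<in> hol_\<Omega>" "G \<in> hol_\<Omega>" using F G by (auto simp: eigenspace_\<Omega>_def)
  obtain f where f: "f holomorphic_on UNIV" "\<And>p. p \<in> \<Omega> \<Longrightarrow> F p = f (xi p q)"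
    using invariant_factors_through_xi[OF hol(1) F(2) q] by blast
  obtain g where g: "g holomorphic_on UNIV" "\<And>p. p \<in> \<Omega> \<Longrightarrow> G p = g (xi p q)"
    using invariant_factors_through_xi[OF hol(2) G(2) q] by blast
  have xiq: "xi q q = 1" unfolding xi_def by (rule zonal_kernel_diag[OF q])
  define c where "c = F q / G q"
  define u where "u x = f x - c * g x" for x
  have u: "u holomorphic_on UNIV" unfolding u_def by (intro holomorphic_intros f(1) g(1))
  have f1: "(f has_field_derivative deriv f x) (at x)" "(deriv f has_field_derivative deriv (deriv f) x) (at x)"
   and g1: "(g has_field_derivative deriv g x) (at x)" "(deriv g has_field_derivative deriv (deriv g) x) (at x)" for x
    using holomorphic_derivI[OF _ open_UNIV UNIV_I] holomorphic_deriv[OF _ open_UNIV] f(1) g(1) by blast+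
  have du: "deriv u = (\<lambda>x. deriv f x - c * deriv g x)"
    unfolding u_def by (rule ext) (intro DERIV_imp_deriv DERIV_diff DERIV_cmult f1 g1)
  have ddu: "deriv (deriv u) = (\<lambda>x. deriv (deriv f) x - c * deriv (deriv g) x)"
    unfolding du by (rule ext) (intro DERIV_imp_deriv DERIV_diff DERIV_cmult f1 g1)
  have "(x\<^sup>2 - 1) * deriv (deriv u) x + 2 * x * deriv u x = l / 4 * u x" for x
  proof -
    have "(x\<^sup>2 - 1) * deriv (deriv u) x + 2 * x * deriv u x =
       ((x\<^sup>2 - 1) * deriv (deriv f) x + 2 * x * deriv f x)
         - c * ((x\<^sup>2 - 1) * deriv (deriv g) x + 2 * x * deriv g x)"
      by (simp only: ddu) (simp add: du algebra_simps)
    also have "\<dots> = l / 4 * f x - c * (l / 4 * g x)"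
      by (simp only: eigenfunction_legendre[OF q F(1) f] eigenfunction_legendre[OF q G(1) g])
    also have "\<dots> = l / 4 * u x" by (simp add: u_def algebra_simps)
    finally show ?thesis .
  qed
  moreover have "u 1 = 0"
    using f(2)[OF q] g(2)[OF q] G(3) by (simp add: u_def c_def xiq)
  ultimately have "u (xi p q) = 0" using legendre_unique[OF u] by blast
  then show ?thesis using f(2)[OF p] g(2)[OF p] by (simp add: u_def c_def)
qed

theorem theorem7p9:
  fixes m :: nat
  shows "(\<forall>S\<in>moebius_group_\<Omega>. \<forall>p\<in>\<Omega>. \<forall>q\<in>\<Omega>. zonal m (S p) (S q) = zonal m p q) \<and>
    (\<exists>\<Phi> :: sphere \<times> sphere \<Rightarrow> complex.
       (\<forall>u v. (Fin u, Fin v) \<in> \<Omega> \<longrightarrow>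
          (\<forall>p\<in>\<Omega>. zonal m p (Fin u, Fin v) = \<Phi> (T_map u v p))) \<and>
       (\<forall>u v. (u, v) \<in> \<Omega> \<and> u \<noteq> Fin 0 \<and> v \<noteq> Fin 0 \<longrightarrow>
          (\<forall>p\<in>\<Omega>. zonal m p (u, v) = \<Phi> (T_tilde u v p)))) \<and>
    (\<forall>q\<in>\<Omega>.
       (\<lambda>p. zonal m p q) \<in> eigenspace_\<Omega> (4 * of_nat m * (of_nat m + 1)) \<and>
       stabilizer_invariant q (\<lambda>p. zonal m p q) \<and>
       (\<exists>p\<in>\<Omega>. zonal m p q \<noteq> 0) \<and>
       (\<forall>F\<in>eigenspace_\<Omega> (4 * of_nat m * (of_nat m + 1)). stabilizer_invariant q F \<longrightarrow>
          (\<exists>c. \<forall>p\<in>\<Omega>. F p = c * zonal m p q)))"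
proof (intro conjI ballI)
  fix S p q assume "S \<in> moebius_group_\<Omega>" "p \<in> \<Omega>" "q \<in> \<Omega>"
  then show "zonal m (S p) (S q) = zonal m p q" by (rule zonal_invariant)
next
  show "\<exists>\<Phi> :: sphere \<times> sphere \<Rightarrow> complex.
       (\<forall>u v. (Fin u, Fin v) \<in> \<Omega> \<longrightarrow>
          (\<forall>p\<in>\<Omega>. zonal m p (Fin u, Fin v) = \<Phi> (T_map u v p))) \<and>
       (\<forall>u v. (u, v) \<in> \<Omega> \<and> u \<noteq> Fin 0 \<and> v \<noteq> Fin 0 \<longrightarrow>
          (\<forall>p\<in>\<Omega>. zonal m p (u, v) = \<Phi> (T_tilde u v p)))"
    by (intro exI[of _ "\<lambda>p. zonal m p origin"] conjI allI impI ballI)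
      (auto intro: zonal_T_map zonal_T_tilde)
next
  fix q assume q: "q \<in> \<Omega>"
  show eigen: "(\<lambda>p. zonal m p q) \<in> eigenspace_\<Omega> (4 * of_nat m * (of_nat m + 1))"
    by (rule zonal_eigenfunction[OF q])
  show inv: "stabilizer_invariant q (\<lambda>p. zonal m p q)"
    by (rule zonal_stabilizer_invariant[OF q])
  have "zonal m q q = of_nat (2 * m + 1)"
    by (simp add: zonal_eq_kernel q zonal_kernel_diag)
  then have ne: "zonal m q q \<noteq> 0" by (simp only: of_nat_eq_0_iff)
  then show "\<exists>p\<in>\<Omega>. zonal m p q \<noteq> 0" using q by blast
  fix F assume F: "F \<in> eigenspace_\<Omega> (4 * of_nat m * (of_nat m + 1))"
  show "stabilizer_invariant q F \<longrightarrow> (\<exists>c. \<forall>p\<in>\<Omega>. F p = c * zonal m p q)"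
    using invariant_eigenfunction_unique[OF q F _ eigen inv ne] by blast
qed

end
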